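(* Let the controlled Markov process $(X_n)_{n=0}^N$, the training distribution $\mu$, the transition density $r\le\bar R^2$, the bounded measurable rewards $f,g$, the value function $V$ with bound $\Gamma$, the basis functions $\phi_1,\dots,\phi_K$ (with Gram matrix $\mathcal{A}_K$), and the regress-later value iteration algorithm with $M$ training points per time step be as in the context, with $f(n,x,\cdot)$ and $\hat\phi^n_k(x,\cdot)$ upper semicontinuous in $u$. Let $\tilde V$ be the exact performance of the policy $(\hat u_n)$ estimated by value iteration (defined in the context). Then for all $n=0,1,\dots,N$ \[ \Big\|\tilde V(n,\tilde X)-V(n,\tilde X)\Big\|_{L^2_{e,N-n}}\le\frac{2\bar R}{(\bar R-1)^2}\Big((N-n)\bar R^{N-n+1}-(N-n+1)\bar R^{N-n}+1\Big)\Big(\epsilon_K+\frac{\sqrt K}{\sqrt M}\,\Gamma\,\|\mathcal{A}_K^{-1/2}\|_2\max_{k=1,\dots,K}\|\phi_k\|_{L^2_\mu}\Big), \] where $\epsilon_K=\max_{n=1,\dots,N}\big\|\Pi_K V(n,\cdot)-V(n,\cdot)\big\|_{L^2_\mu}$.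
   Context: Controlled process. $\mathcal{D}\subseteq\mathbb{R}^d$ is the (Borel) state space, $\mathcal{D}^U\subset\mathbb{R}^q$ is a compact set of control values, $N,M,K\ge 1$ are integers. The process is $X_{n+1}=\varphi(n,X_n,\xi_n,u_n)$, $n=0,\dots,N-1$, with $\varphi$ Borel measurable, $(\xi_n)$ i.i.d. uniform on $[0,1]$, and feedback controls $u_n=u_n(X_n)\in\mathcal{D}^U$ (the set of such controls is $\mathcal{U}$). Density. $\mu$ is a probability measure on $\mathcal{D}$ and $X$ has a (jointly measurable) transition density: $\mathbb{P}(X_{n+1}\in A\mid X_n=x,u_n=u)=\int_A r(n,x,u;y)\,\mu(dy)$, with $r(n,x,u;y)\le\bar R^2$ for all $n,x,u,y$, where $\bar R>0$ is a constant (necessarily $\bar R\ge1$). Rewards and value function. $f(n,x,u)$ and $g(x)$ are measurable and bounded. $V(n,x)=\sup_{u\in\mathcal{U}}\mathbb{E}\big[\sum_{s=n}^{N-1}f(s,X_s,u_s)+g(X_N)\mid X_n=x\big]$; equivalently $V(N,x)=g(x)$ and $V(n,x)=\max_{u\in\mathcal{D}^U}\{f(n,x,u)+\mathbb{E}[V(n+1,X_{n+1})\mid X_n=x,u_n=u]\}$. $\Gamma$ is a constant with $|V(n,x)|\le\Gamma$ for all $n=0,\dots,N$, $x\in\mathcal{D}$. Functions of $x$ obtained by optimising over $u$ are understood to be measurable. Basis functions. $L^2_\mu=L^2(\mathcal{D},\mu)$. $\phi_1,\dots,\phi_K\in L^2_\mu$ are linearly independent, $\pmb\phi=(\phi_1,\dots,\phi_K)^T$,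 $\mathcal{A}_K=\int\pmb\phi\pmb\phi^T d\mu$ (a $K\times K$ matrix), $\|\cdot\|_2$ of a matrix is the operator norm induced by the Euclidean norm. $\Pi_K$ is the orthogonal projection in $L^2_\mu$ onto $\mathrm{lin}(\phi_1,\dots,\phi_K)$. $\hat\phi_k^n(x,u)=\mathbb{E}[\phi_k(X_{n+1})\mid X_n=x,u_n=u]=\int_{\mathcal{D}}\phi_k(y)r(n,x,u;y)\mu(dy)$. Value iteration. Let $\tilde X^m_s$, $m=1,\dots,M$, $s=1,\dots,N$, be i.i.d. with law $\mu$ (training points). Put $\hat V(N,x)=g(x)$, and for $n=N-1,\dots,0$: $\hat{\pmb\alpha}^{n+1}=\mathcal{A}_K^{-1}\frac1M\sum_{m=1}^M\hat V(n+1,\tilde X^m_{n+1})\pmb\phi(\tilde X^m_{n+1})$, $\hat V(n,x)=\max\big\{-\Gamma,\min\{\Gamma,\ \sup_{u\in\mathcal{D}^U}\{f(n,x,u)+\sum_{k=1}^K\hat\alpha^{n+1}_k\hat\phi^n_k(x,u)\}\}\big\}$. Estimated policy and its performance. $\hat u_n(x)\in\mathrm{argmax}_{u\in\mathcal{D}^U}\{f(n,x,u)+\sum_{k=1}^K\hat\alpha_k^{n+1}\hat\phi_k^n(x,u)\}$, a maximiser (taken to exist and to be measurable jointly in $x$ and the training points $\tilde X^m_s$, $s\ge n+1$, on which it depends through $\hat{\pmb\alpha}^{n+1}$). $\tilde V(N,x)=g(x)$ and $\tilde V(n,x)=f(n,x,\hat u_n(x))+\int_{\mathcal{D}}\tilde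 V(n+1,y)\,r(n,x,\hat u_n(x);y)\,\mu(dy)$ for $n<N$, i.e. the expectation $\mathbb{E}[\tilde V(n+1,X_{n+1})\mid X_n=x,u_n=\hat u_n(x)]$ is taken with training points held fixed. Thus $\tilde V(n,\cdot)$ depends on the training points $\tilde X^m_s$ with $s=n+1,\dots,N$. Norm. $L^2_{e,j}=L^2(\mathcal{D}^{Mj}\times\mathcal{D},\mu^{Mj}\otimes\mu)$, where the first $Mj$ coordinates are the training points $\tilde X^m_s$, $m=1,\dots,M$, $s=N-j+1,\dots,N$, and the last coordinate is an independent $\tilde X\sim\mu$. When $\bar R=1$, the factor $\frac{1}{(\bar R-1)^2}\big(j\bar R^{j+1}-(j+1)\bar R^{j}+1\big)$ is read as its limit $j(j+1)/2$. *)

theory Defs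
  imports "HOL-Probability.Probability"
begin

definition l2_space :: "'a measure \<Rightarrow> ('a \<Rightarrow> real) set" where
  "l2_space M = {h \<in> borel_measurable M. integrable M (\<lambda>x. (h x)\<^sup>2)}"

text \<open>Only meaningful on \<^const>\<open>l2_space\<close>: the Bochner integral of a non-integrable function is 0.\<close>

definition l2_norm :: "'a measure \<Rightarrow> ('a \<Rightarrow> real) \<Rightarrow> real" where
  "l2_norm M h = sqrt (\<integral>x. (h x)\<^sup>2 \<partial>M)"

definition lin_span :: "('k::finite \<Rightarrow> 'a \<Rightarrow> real) \<Rightarrow> ('a \<Rightarrow> real) set" where
  "lin_span \<phi> = {\<lambda>x. \<Sum>k\<in>UNIV. c k * \<phi> k x | c. True}"

text \<open>Functions are identified when they agree almost everywhere.\<close>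

definition l2_independent :: "'a measure \<Rightarrow> ('k::finite \<Rightarrow> 'a \<Rightarrow> real) \<Rightarrow> bool" where
  "l2_independent M \<phi> \<longleftrightarrow>
     (\<forall>c. (AE x in M. (\<Sum>k\<in>UNIV. c k * \<phi> k x) = 0) \<longrightarrow> (\<forall>k. c k = 0))"

text \<open>The orthogonal projection onto the span of \<open>\<phi>\<close>. For \<open>h\<close> and \<open>\<phi> k\<close> square-integrable and
  \<open>\<phi>\<close> independent there is exactly one such \<open>p\<close>.\<close>

definition l2_proj :: "'a measure \<Rightarrow> ('k::finite \<Rightarrow> 'a \<Rightarrow> real) \<Rightarrow> ('a \<Rightarrow> real) \<Rightarrow> 'a \<Rightarrow> real" where
  "l2_proj M \<phi> h =
     (SOME p. p \<in> lin_span \<phi> \<and> (\<forall>q\<in>lin_span \<phi>. (\<integral>x. (h x - p x) * q x \<partial>M) = 0))"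

definition gram :: "'a measure \<Rightarrow> ('k::finite \<Rightarrow> 'a \<Rightarrow> real) \<Rightarrow> real^'k^'k" where
  "gram M \<phi> = (\<chi> i j. \<integral>x. \<phi> i x * \<phi> j x \<partial>M)"

text \<open>The unique symmetric positive semidefinite square root of a symmetric positive semidefinite
  matrix.\<close>

definition psd_sqrt :: "real^'k^'k \<Rightarrow> real^'k^'k" where
  "psd_sqrt A = (SOME B. transpose B = B \<and> (\<forall>v. 0 \<le> v \<bullet> (B *v v)) \<and> B ** B = A)"

definition upper_semicontinuous_on :: "'a::topological_space set \<Rightarrow> ('a \<Rightarrow> real) \<Rightarrow> bool" where
  "upper_semicontinuous_on S h \<longleftrightarrow>
     (\<forall>x\<in>S. \<forall>a>h x. eventually (\<lambda>y. h y < a) (at x within S))"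

definition unif01 :: "real measure" where
  "unif01 = restrict_space lborel {0..1}"

definition feedback_controls ::
  "nat \<Rightarrow> 'x::topological_space set \<Rightarrow> 'u::topological_space set \<Rightarrow> (nat \<Rightarrow> 'x \<Rightarrow> 'u) set" where
  "feedback_controls N D U =
     {u. \<forall>n<N. u n \<in> measurable (restrict_space borel D) (restrict_space borel U)}"

text \<open>\<open>state_after dyn u \<xi> n x j\<close> is the state \<open>X\<^bsub>n+j\<^esub>\<close> of the process driven by the noise \<open>\<xi>\<close>
  and the control \<open>u\<close> when \<open>X\<^bsub>n\<^esub> = x\<close>.\<close>

primrec state_after ::
  "(nat \<Rightarrow> 'x \<Rightarrow> real \<Rightarrow> 'u \<Rightarrow> 'x) \<Rightarrow> (nat \<Rightarrow> 'x \<Rightarrow> 'u) \<Rightarrow> (nat \<Rightarrow> real) \<Rightarrow> nat \<Rightarrow> 'x \<Rightarrow> nat \<Rightarrow> 'x" where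
  "state_after dyn u \<xi> n x 0 = x"
| "state_after dyn u \<xi> n x (Suc j) =
     (let X = state_after dyn u \<xi> n x j in dyn (n + j) X (\<xi> (n + j)) (u (n + j) X))"

definition expected_reward ::
  "nat \<Rightarrow> (nat \<Rightarrow> 'x \<Rightarrow> real \<Rightarrow> 'u \<Rightarrow> 'x) \<Rightarrow> (nat \<Rightarrow> 'x \<Rightarrow> 'u \<Rightarrow> real) \<Rightarrow> ('x \<Rightarrow> real)
     \<Rightarrow> (nat \<Rightarrow> 'x \<Rightarrow> 'u) \<Rightarrow> nat \<Rightarrow> 'x \<Rightarrow> real" where
  "expected_reward N dyn f g u n x =
     (\<integral>\<xi>. (\<Sum>s=n..<N. f s (state_after dyn u \<xi> n x (s - n))
                        (u s (state_after dyn u \<xi> n x (s - n))))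
          + g (state_after dyn u \<xi> n x (N - n)) \<partial>(PiM {..<N} (\<lambda>_. unif01)))"

definition value_fn ::
  "nat \<Rightarrow> 'x::topological_space set \<Rightarrow> 'u::topological_space set
     \<Rightarrow> (nat \<Rightarrow> 'x \<Rightarrow> real \<Rightarrow> 'u \<Rightarrow> 'x) \<Rightarrow> (nat \<Rightarrow> 'x \<Rightarrow> 'u \<Rightarrow> real) \<Rightarrow> ('x \<Rightarrow> real)
     \<Rightarrow> nat \<Rightarrow> 'x \<Rightarrow> real" where
  "value_fn N D U dyn f g n x =
     (SUP u\<in>feedback_controls N D U. expected_reward N dyn f g u n x)"

text \<open>A training sample is a function \<open>\<omega>\<close> with \<open>\<omega> (m, s)\<close> the \<open>m\<close>-th training point for time \<open>s\<close>.\<close>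

definition basis_hat ::
  "'x measure \<Rightarrow> (nat \<Rightarrow> 'x \<Rightarrow> 'u \<Rightarrow> 'x \<Rightarrow> real) \<Rightarrow> ('k \<Rightarrow> 'x \<Rightarrow> real)
     \<Rightarrow> nat \<Rightarrow> 'k \<Rightarrow> 'x \<Rightarrow> 'u \<Rightarrow> real" where
  "basis_hat \<mu> r \<phi> n k x u = (\<integral>y. \<phi> k y * r n x u y \<partial>\<mu>)"

definition approx_Q ::
  "'x measure \<Rightarrow> (nat \<Rightarrow> 'x \<Rightarrow> 'u \<Rightarrow> 'x \<Rightarrow> real) \<Rightarrow> (nat \<Rightarrow> 'x \<Rightarrow> 'u \<Rightarrow> real)
     \<Rightarrow> ('k::finite \<Rightarrow> 'x \<Rightarrow> real) \<Rightarrow> nat \<Rightarrow> real^'k \<Rightarrow> 'x \<Rightarrow> 'u \<Rightarrow> real" where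
  "approx_Q \<mu> r f \<phi> n a x u = f n x u + (\<Sum>k\<in>UNIV. a $ k * basis_hat \<mu> r \<phi> n k x u)"

definition regression_coeff ::
  "nat \<Rightarrow> 'x measure \<Rightarrow> ('k::finite \<Rightarrow> 'x \<Rightarrow> real) \<Rightarrow> (nat \<times> nat \<Rightarrow> 'x) \<Rightarrow> nat
     \<Rightarrow> ('x \<Rightarrow> real) \<Rightarrow> real^'k" where
  "regression_coeff M \<mu> \<phi> \<omega> s h =
     matrix_inv (gram \<mu> \<phi>) *v
       ((1 / real M) *\<^sub>R (\<Sum>m=1..M. h (\<omega> (m, s)) *\<^sub>R (\<chi> k. \<phi> k (\<omega> (m, s)))))"

function V_hat ::
  "nat \<Rightarrow> nat \<Rightarrow> 'u set \<Rightarrow> 'x measure \<Rightarrow> (nat \<Rightarrow> 'x \<Rightarrow> 'u \<Rightarrow> 'x \<Rightarrow> real)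
     \<Rightarrow> (nat \<Rightarrow> 'x \<Rightarrow> 'u \<Rightarrow> real) \<Rightarrow> ('x \<Rightarrow> real) \<Rightarrow> real \<Rightarrow> ('k::finite \<Rightarrow> 'x \<Rightarrow> real)
     \<Rightarrow> (nat \<times> nat \<Rightarrow> 'x) \<Rightarrow> nat \<Rightarrow> 'x \<Rightarrow> real" where
  "V_hat N M U \<mu> r f g \<Gamma> \<phi> \<omega> n =
     (if N \<le> n then g
      else (\<lambda>x. max (- \<Gamma>) (min \<Gamma>
        (SUP u\<in>U. approx_Q \<mu> r f \<phi> n
           (regression_coeff M \<mu> \<phi> \<omega> (Suc n) (V_hat N M U \<mu> r f g \<Gamma> \<phi> \<omega> (Suc n))) x u))))"
  by pat_completeness auto
termination
  by (relation "Wellfounded.measure (\<lambda>(N, M, U, \<mu>, r, f, g, \<Gamma>, \<phi>, \<omega>, n). N - n)") auto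

declare V_hat.simps [simp del]

definition alpha_hat ::
  "nat \<Rightarrow> nat \<Rightarrow> 'u set \<Rightarrow> 'x measure \<Rightarrow> (nat \<Rightarrow> 'x \<Rightarrow> 'u \<Rightarrow> 'x \<Rightarrow> real)
     \<Rightarrow> (nat \<Rightarrow> 'x \<Rightarrow> 'u \<Rightarrow> real) \<Rightarrow> ('x \<Rightarrow> real) \<Rightarrow> real \<Rightarrow> ('k::finite \<Rightarrow> 'x \<Rightarrow> real)
     \<Rightarrow> (nat \<times> nat \<Rightarrow> 'x) \<Rightarrow> nat \<Rightarrow> real^'k" where
  "alpha_hat N M U \<mu> r f g \<Gamma> \<phi> \<omega> s =
     regression_coeff M \<mu> \<phi> \<omega> s (V_hat N M U \<mu> r f g \<Gamma> \<phi> \<omega> s)"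

text \<open>The exact performance of the policy that plays \<open>u_hat n a x\<close> at time \<open>n\<close> in state \<open>x\<close>, where
  \<open>a\<close> is the coefficient vector estimated for time \<open>n + 1\<close>.\<close>

function V_tilde ::
  "nat \<Rightarrow> nat \<Rightarrow> 'u set \<Rightarrow> 'x measure \<Rightarrow> (nat \<Rightarrow> 'x \<Rightarrow> 'u \<Rightarrow> 'x \<Rightarrow> real)
     \<Rightarrow> (nat \<Rightarrow> 'x \<Rightarrow> 'u \<Rightarrow> real) \<Rightarrow> ('x \<Rightarrow> real) \<Rightarrow> real \<Rightarrow> ('k::finite \<Rightarrow> 'x \<Rightarrow> real)
     \<Rightarrow> (nat \<Rightarrow> real^'k \<Rightarrow> 'x \<Rightarrow> 'u) \<Rightarrow> (nat \<times> nat \<Rightarrow> 'x) \<Rightarrow> nat \<Rightarrow> 'x \<Rightarrow> real" where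
  "V_tilde N M U \<mu> r f g \<Gamma> \<phi> u_hat \<omega> n =
     (if N \<le> n then g
      else (\<lambda>x. let u = u_hat n (alpha_hat N M U \<mu> r f g \<Gamma> \<phi> \<omega> (Suc n)) x in
        f n x u + (\<integral>y. V_tilde N M U \<mu> r f g \<Gamma> \<phi> u_hat \<omega> (Suc n) y * r n x u y \<partial>\<mu>)))"
  by pat_completeness auto
termination
  by (relation "Wellfounded.measure (\<lambda>(N, M, U, \<mu>, r, f, g, \<Gamma>, \<phi>, u_hat, \<omega>, n). N - n)") auto

declare V_tilde.simps [simp del]

text \<open>The law of the training points for the last \<open>j\<close> time steps together with an independent
  state of law \<open>\<mu>\<close>.\<close>

definition train_measure :: "'x measure \<Rightarrow> nat \<Rightarrow> nat \<Rightarrow> nat \<Rightarrow> ((nat \<times> nat \<Rightarrow> 'x) \<times> 'x) measure" where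
  "train_measure \<mu> N M j = PiM ({1..M} \<times> {N - j + 1..N}) (\<lambda>_. \<mu>) \<Otimes>\<^sub>M \<mu>"

text \<open>The value at \<open>R = 1\<close> is the limit of the other branch.\<close>

definition growth_factor :: "real \<Rightarrow> nat \<Rightarrow> real" where
  "growth_factor R j =
     (if R = 1 then real j * (real j + 1) / 2
      else 1 / (R - 1)\<^sup>2 * (real j * R ^ (j + 1) - (real j + 1) * R ^ j + 1))"

end

theory Submission
  imports Defs
begin

text \<open>
  Fix the training points and let \<open>\<delta>\<close> be \<open>R\<close> times the \<open>L\<^sup>2(\<mu>)\<close> distance between the regression
  function \<open>\<Sum>\<^sub>k \<alpha>\<^sub>k \<phi>\<^sub>k\<close> and \<open>V (n + 1)\<close>. Since the density has \<open>L\<^sup>2\<close> norm at most \<open>R\<close>, the estimated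
  and the true state-action values differ by at most \<open>\<delta>\<close>, uniformly in state and control. Hence
  \<open>\<bar>V_hat n - V n\<bar> \<le> \<delta>\<close> and \<open>\<bar>V_tilde n - V n\<bar> \<le> 2 \<delta> + R * \<parallel>V_tilde (n + 1) - V (n + 1)\<parallel>\<close>.
  Writing the regression as the projection of \<open>V_hat (n + 1)\<close> plus Monte Carlo noise, \<open>\<delta>\<close> is at most \<open>R\<close>
  times the sum of the noise, of \<open>\<parallel>V_hat (n + 1) - V (n + 1)\<parallel>\<close> and of the projection error of
  \<open>V (n + 1)\<close>. The noise is \<open>A\<^sup>-\<^sup>1\<^sup>/\<^sup>2\<close> applied to the error of a Monte Carlo mean, conditionally on the later
  training points, which gives the term in \<open>\<surd>K / \<surd>M\<close>. Minkowski's inequality over the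
  training points turns these bounds into two linear recursions in \<open>n\<close>. It is convenient to
  integrate over all \<open>M N\<close> training points, of which \<open>V_tilde n\<close> only sees those after time \<open>n\<close>.
\<close>

section \<open>Square-integrable functions\<close>

lemma l2_spaceI:
  "h \<in> borel_measurable M \<Longrightarrow> integrable M (\<lambda>x. (h x)\<^sup>2) \<Longrightarrow> h \<in> l2_space M"
  by (simp add: l2_space_def)

lemma l2_spaceD:
  assumes "h \<in> l2_space M"
  shows "h \<in> borel_measurable M" "integrable M (\<lambda>x. (h x)\<^sup>2)"
  using assms by (auto simp: l2_space_def)

lemma l2_norm_nonneg: "0 \<le> l2_norm M h"
  by (simp add: l2_norm_def)

lemma l2_norm_power2: "(l2_norm M h)\<^sup>2 = (\<integral>x. (h x)\<^sup>2 \<partial>M)"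
  by (simp add: l2_norm_def)

lemma l2_norm_cong:
  "(\<And>x. x \<in> space M \<Longrightarrow> h x = h' x) \<Longrightarrow> l2_norm M h = l2_norm M h'"
  unfolding l2_norm_def by (metis (no_types, lifting) Bochner_Integration.integral_cong)

lemma l2_space_integrable_mult:
  assumes "h \<in> l2_space M" "h' \<in> l2_space M"
  shows "integrable M (\<lambda>x. h x * h' x)"
proof (rule Bochner_Integration.integrable_bound)
  show "integrable M (\<lambda>x. (h x)\<^sup>2 + (h' x)\<^sup>2)"
    using assms by (intro Bochner_Integration.integrable_add l2_spaceD)
  show "(\<lambda>x. h x * h' x) \<in> borel_measurable M"
    using assms by (intro borel_measurable_times l2_spaceD(1))
  have "\<bar>a * b\<bar> \<le> \<bar>a\<^sup>2 + b\<^sup>2\<bar>" for a b :: real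
  proof -
    have "2 * (\<bar>a\<bar> * \<bar>b\<bar>) \<le> \<bar>a\<bar>\<^sup>2 + \<bar>b\<bar>\<^sup>2"
      using sum_squares_bound[of "\<bar>a\<bar>" "\<bar>b\<bar>"] by (simp only: mult.assoc)
    moreover have "0 \<le> \<bar>a\<bar> * \<bar>b\<bar>" by simp
    ultimately show ?thesis by (simp only: abs_mult power2_abs)
  qed
  then show "AE x in M. norm (h x * h' x) \<le> norm ((h x)\<^sup>2 + (h' x)\<^sup>2)"
    by simp
qed

lemma l2_space_add:
  assumes "h \<in> l2_space M" "h' \<in> l2_space M"
  shows "(\<lambda>x. h x + h' x) \<in> l2_space M"
proof (rule l2_spaceI)
  show "(\<lambda>x. h x + h' x) \<in> borel_measurable M"
    using assms by (intro borel_measurable_add l2_spaceD(1))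
  have "integrable M (\<lambda>x. (h x)\<^sup>2 + (h' x)\<^sup>2 + 2 * (h x * h' x))"
    using assms
    by (intro Bochner_Integration.integrable_add l2_spaceD integrable_mult_right
        l2_space_integrable_mult)
  then show "integrable M (\<lambda>x. (h x + h' x)\<^sup>2)"
    by (simp add: power2_sum algebra_simps)
qed

lemma l2_space_mult_left:
  "h \<in> l2_space M \<Longrightarrow> (\<lambda>x. c * h x) \<in> l2_space M"
  by (auto simp: l2_space_def power_mult_distrib)

lemma l2_space_diff:
  assumes "h \<in> l2_space M" "h' \<in> l2_space M"
  shows "(\<lambda>x. h x - h' x) \<in> l2_space M"
  using l2_space_add[OF assms(1) l2_space_mult_left[OF assms(2), of "-1"]] by simp

lemma l2_space_sum:
  assumes "\<And>i. i \<in> I \<Longrightarrow> h i \<in> l2_space M"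
  shows "(\<lambda>x. \<Sum>i\<in>I. h i x) \<in> l2_space M"
  using assms
proof (induction I rule: infinite_finite_induct)
  case (insert i I)
  then show ?case by (simp add: l2_space_add)
qed (simp_all add: l2_space_def)

text \<open>With \<open>b\<close> the truncated estimate and \<open>h\<close> a basis function, this
  is the source of the factor \<open>\<Gamma>\<close> in the statistical error.\<close>

lemma l2_space_bounded_mult:
  assumes b: "b \<in> borel_measurable M" "\<And>x. x \<in> space M \<Longrightarrow> \<bar>b x\<bar> \<le> C" and h: "h \<in> l2_space M"
  shows "(\<lambda>x. b x * h x) \<in> l2_space M"
    and "(\<integral>x. (b x * h x)\<^sup>2 \<partial>M) \<le> C\<^sup>2 * (\<integral>x. (h x)\<^sup>2 \<partial>M)"
proof -
  have le: "(b x * h x)\<^sup>2 \<le> C\<^sup>2 * (h x)\<^sup>2" if "x \<in> space M" for x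
    using power_mono[OF b(2)[OF that], of 2] by (simp add: power_mult_distrib mult_right_mono)
  have int: "integrable M (\<lambda>x. C\<^sup>2 * (h x)\<^sup>2)"
    using h by (intro integrable_mult_right l2_spaceD)
  have meas: "(\<lambda>x. b x * h x) \<in> borel_measurable M"
    using b(1) l2_spaceD(1)[OF h] by (intro borel_measurable_times)
  have int': "integrable M (\<lambda>x. (b x * h x)\<^sup>2)"
    using le by (intro Bochner_Integration.integrable_bound[OF int] borel_measurable_power meas AE_I2) simp
  show "(\<lambda>x. b x * h x) \<in> l2_space M"
    using meas int' by (rule l2_spaceI)
  have "(\<integral>x. (b x * h x)\<^sup>2 \<partial>M) \<le> (\<integral>x. C\<^sup>2 * (h x)\<^sup>2 \<partial>M)"
    using int' int le by (rule integral_mono)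
  then show "(\<integral>x. (b x * h x)\<^sup>2 \<partial>M) \<le> C\<^sup>2 * (\<integral>x. (h x)\<^sup>2 \<partial>M)"
    by simp
qed

lemma (in finite_measure) l2_space_bounded:
  assumes "h \<in> borel_measurable M" "\<And>x. x \<in> space M \<Longrightarrow> \<bar>h x\<bar> \<le> C"
  shows "h \<in> l2_space M"
  using l2_space_bounded_mult(1)[OF assms, of "\<lambda>_. 1"] by (simp add: l2_space_def)

lemma (in finite_measure) l2_space_imp_integrable:
  "h \<in> l2_space M \<Longrightarrow> integrable M h"
  by (auto simp: l2_space_def intro: square_integrable_imp_integrable)

lemma l2_norm_const: "prob_space M \<Longrightarrow> l2_norm M (\<lambda>_. c) = \<bar>c\<bar>"
  by (simp add: l2_norm_def prob_space.prob_space)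

lemma l2_norm_mult_left: "l2_norm M (\<lambda>x. c * h x) = \<bar>c\<bar> * l2_norm M h"
  by (simp add: l2_norm_def power_mult_distrib real_sqrt_mult)

lemma l2_norm_mono:
  assumes "h \<in> borel_measurable M" "h' \<in> l2_space M" "\<And>x. x \<in> space M \<Longrightarrow> \<bar>h x\<bar> \<le> h' x"
  shows "l2_norm M h \<le> l2_norm M h'"
proof -
  have le: "(h x)\<^sup>2 \<le> (h' x)\<^sup>2" if "x \<in> space M" for x
    using power_mono[OF assms(3)[OF that], of 2] by simp
  have "integrable M (\<lambda>x. (h x)\<^sup>2)"
    using le assms
    by (intro Bochner_Integration.integrable_bound[OF l2_spaceD(2)[OF assms(2)]]) auto
  then show ?thesis
    unfolding l2_norm_def using le l2_spaceD(2)[OF assms(2)]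
    by (intro real_sqrt_le_mono integral_mono) auto
qed

text \<open>The integral of the square of \<open>t * h + s * h'\<close> is a nonnegative quadratic
  form in \<open>t\<close> and \<open>s\<close>. Suitable values of the two parameters give the
  bound on the mixed coefficient.\<close>

lemma l2_norm_Cauchy_Schwarz:
  assumes h: "h \<in> l2_space M" and h': "h' \<in> l2_space M"
  shows "\<bar>\<integral>x. h x * h' x \<partial>M\<bar> \<le> l2_norm M h * l2_norm M h'"
proof -
  let ?a = "\<integral>x. (h x)\<^sup>2 \<partial>M" and ?b = "\<integral>x. (h' x)\<^sup>2 \<partial>M" and ?c = "\<integral>x. h x * h' x \<partial>M"
  have q: "0 \<le> t\<^sup>2 * ?a + 2 * t * s * ?c + s\<^sup>2 * ?b" for t s
  proof -
    have "0 \<le> (\<integral>x. (t * h x + s * h' x)\<^sup>2 \<partial>M)" by simp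
    also have "\<dots> = (\<integral>x. t\<^sup>2 * (h x)\<^sup>2 + 2 * t * s * (h x * h' x) + s\<^sup>2 * (h' x)\<^sup>2 \<partial>M)"
      by (rule Bochner_Integration.integral_cong) (auto simp: power2_eq_square algebra_simps)
    also have "\<dots> = t\<^sup>2 * ?a + 2 * t * s * ?c + s\<^sup>2 * ?b"
      using l2_spaceD(2)[OF h] l2_spaceD(2)[OF h'] l2_space_integrable_mult[OF h h'] by simp
    finally show ?thesis .
  qed
  have a: "0 \<le> ?a" and b: "0 \<le> ?b" by simp_all
  have "?c\<^sup>2 \<le> ?a * ?b"
  proof (cases "?b = 0")
    case True
    have "?c = 0"
    proof (rule ccontr)
      assume "?c \<noteq> 0"
      \<comment> \<open>With \<open>?b = 0\<close> and \<open>t = 1\<close> the form is affine in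
        \<open>s\<close>; this \<open>s\<close> would make it equal to -1.\<close>
      have "0 \<le> ?a + 2 * (- (?a + 1) / (2 * ?c)) * ?c"
        using q[of 1 "- (?a + 1) / (2 * ?c)"] True by simp
      then show False using \<open>?c \<noteq> 0\<close> by (simp add: field_simps)
    qed
    then show ?thesis using True by simp
  next
    case False
    \<comment> \<open>The choice \<open>t = ?b\<close>, \<open>s = - ?c\<close> factors out
      \<open>?b\<close>, which can then be cancelled because it is positive.\<close>
    have "0 \<le> ?b * (?b * ?a - ?c\<^sup>2)"
      using q[of ?b "- ?c"] by (simp add: power2_eq_square algebra_simps)
    then show ?thesis using False b by (simp add: zero_le_mult_iff mult.commute)
  qed
  then show ?thesis
    unfolding l2_norm_def real_sqrt_mult[symmetric] by (simp add: real_le_rsqrt)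
qed

lemma l2_norm_triangle:
  assumes h: "h \<in> l2_space M" and h': "h' \<in> l2_space M"
  shows "l2_norm M (\<lambda>x. h x + h' x) \<le> l2_norm M h + l2_norm M h'"
proof (rule power2_le_imp_le)
  have "(l2_norm M (\<lambda>x. h x + h' x))\<^sup>2 = (\<integral>x. (h x)\<^sup>2 + 2 * (h x * h' x) + (h' x)\<^sup>2 \<partial>M)"
    unfolding l2_norm_power2
    by (rule Bochner_Integration.integral_cong) (auto simp: power2_eq_square algebra_simps)
  also have "\<dots> = (l2_norm M h)\<^sup>2 + 2 * (\<integral>x. h x * h' x \<partial>M) + (l2_norm M h')\<^sup>2"
    using l2_spaceD(2)[OF h] l2_spaceD(2)[OF h'] l2_space_integrable_mult[OF h h']
    by (simp add: l2_norm_power2)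
  also have "\<dots> \<le> (l2_norm M h + l2_norm M h')\<^sup>2"
    using l2_norm_Cauchy_Schwarz[OF h h'] by (simp add: power2_sum abs_le_iff)
  finally show "(l2_norm M (\<lambda>x. h x + h' x))\<^sup>2 \<le> (l2_norm M h + l2_norm M h')\<^sup>2" .
qed (simp add: l2_norm_nonneg)

text \<open>A measure-preserving map leaves square integrals unchanged. It is applied to single
  coordinates of a product, to the first projection of a pair, and to the map that drops training
  points.\<close>

lemma l2_norm_distr:
  assumes T: "T \<in> measurable M M'" and "distr M M' T = M'" and h: "h \<in> borel_measurable M'"
  shows "l2_norm M (\<lambda>x. h (T x)) = l2_norm M' h"
    and "(\<lambda>x. h (T x)) \<in> l2_space M \<longleftrightarrow> h \<in> l2_space M'"
proof -
  have sq: "(\<lambda>x. (h x)\<^sup>2) \<in> borel_measurable M'"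
    using h by simp
  show "l2_norm M (\<lambda>x. h (T x)) = l2_norm M' h"
    using integral_distr[OF T sq] assms(2) by (simp add: l2_norm_def)
  show "(\<lambda>x. h (T x)) \<in> l2_space M \<longleftrightarrow> h \<in> l2_space M'"
    using integrable_distr_eq[OF T sq] assms(2) h measurable_compose[OF T h] by (simp add: l2_space_def)
qed

section \<open>Square roots of positive semidefinite matrices\<close>

text \<open>The eigenvector is a maximiser of the quadratic form on the unit sphere of \<open>S\<close>.\<close>

lemma selfadjoint_eigenvector:
  fixes T :: "'a::euclidean_space \<Rightarrow> 'a"
  assumes T: "linear T" and adj: "\<And>x y. T x \<bullet> y = x \<bullet> T y"
    and S: "subspace S" "T ` S \<subseteq> S" "S \<noteq> {0}"
  obtains x l where "x \<in> S" "norm x = 1" "T x = l *\<^sub>R x"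
proof -
  have contT: "continuous_on A T" for A
    by (rule linear_continuous_on[OF linear_conv_bounded_linear[THEN iffD1, OF T]])
  let ?S = "S \<inter> sphere 0 1"
  have "compact ?S"
    by (intro closed_Int_compact closed_subspace S compact_sphere)
  moreover have "?S \<noteq> {}"
  proof -
    obtain s where "s \<in> S" "s \<noteq> 0" using S(1,3) subspace_0[OF S(1)] by auto
    then have "s /\<^sub>R norm s \<in> ?S" using S(1) by (simp add: subspace_scale)
    then show ?thesis by blast
  qed
  moreover have "continuous_on ?S (\<lambda>x. x \<bullet> T x)"
    by (intro continuous_on_inner continuous_on_id contT)
  ultimately obtain x where x: "x \<in> ?S" and max: "\<And>y. y \<in> ?S \<Longrightarrow> y \<bullet> T y \<le> x \<bullet> T x"
    using continuous_attains_sup[of ?S "\<lambda>x. x \<bullet> T x"] by blast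
  let ?l = "x \<bullet> T x"
  have nx: "norm x = 1" and xS: "x \<in> S" using x by auto
  have xx: "x \<bullet> x = 1" using nx by (simp add: norm_eq_1)
  \<comment> \<open>Homogeneity of degree two extends the maximum on the unit sphere to all of
    \<open>S\<close>.\<close>
  have psd: "v \<bullet> T v \<le> ?l * (v \<bullet> v)" if v: "v \<in> S" for v
  proof (cases "v = 0")
    case False
    have "v /\<^sub>R norm v \<in> ?S" using False v S(1) by (simp add: subspace_scale)
    from max[OF this] have "(v /\<^sub>R norm v) \<bullet> T (v /\<^sub>R norm v) \<le> ?l" .
    then have "(v \<bullet> T v) / (norm v)\<^sup>2 \<le> ?l"
      by (simp add: linear_scale[OF T] power2_eq_square divide_inverse ac_simps)
    then show ?thesis using False by (simp add: field_simps power2_norm_eq_inner)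
  qed (simp add: linear_0[OF T])
  \<comment> \<open>\<open>w\<close> is the residual of the eigenvalue equation. It is shown to
    vanish by testing the maximality of \<open>x\<close> at the perturbations
    \<open>x + t *\<^sub>R w\<close>.\<close>
  define w where "w = T x - ?l *\<^sub>R x"
  have wS: "w \<in> S" unfolding w_def using xS S by (intro subspace_diff subspace_scale) auto
  have ww: "w \<bullet> w = w \<bullet> T x - ?l * (w \<bullet> x)"
    by (subst (2) w_def) (simp add: inner_diff_right)
  define c where "c = ?l * (w \<bullet> w) - w \<bullet> T w"
  \<comment> \<open>The terms of order zero in \<open>t\<close> cancel and the linear one is
    \<open>2 * t * (w \<bullet> w)\<close>. After division by \<open>t\<close>, the limit at 0 from
    the right leaves no room for a nonzero \<open>w\<close>.\<close>
  have *: "2 * (w \<bullet> w) \<le> t * c" if "t > 0" for t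
  proof -
    have xw: "x \<bullet> T w = w \<bullet> T x" "x \<bullet> w = w \<bullet> x"
      by (metis adj inner_commute, rule inner_commute)
    have 1: "(x + t *\<^sub>R w) \<bullet> T (x + t *\<^sub>R w) \<le> ?l * ((x + t *\<^sub>R w) \<bullet> (x + t *\<^sub>R w))"
      using xS wS S(1) by (intro psd subspace_add subspace_scale)
    have 2: "(x + t *\<^sub>R w) \<bullet> T (x + t *\<^sub>R w) = ?l + 2 * t * (w \<bullet> T x) + t * t * (w \<bullet> T w)"
      by (simp add: linear_add[OF T] linear_scale[OF T] inner_add_left inner_add_right xw
          algebra_simps)
    have 3: "(x + t *\<^sub>R w) \<bullet> (x + t *\<^sub>R w) = 1 + 2 * t * (w \<bullet> x) + t * t * (w \<bullet> w)"
      by (simp add: inner_add_left inner_add_right xx xw algebra_simps)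
    have "t * (2 * (w \<bullet> T x - ?l * (w \<bullet> x))) \<le> t * (t * c)"
      using 1 unfolding 2 3 c_def by (simp add: algebra_simps)
    then show ?thesis
      using that by (simp only: ww mult_le_cancel_left_pos)
  qed
  have "((\<lambda>t. t * c) \<longlongrightarrow> 0 * c) (at_right 0)" by (intro tendsto_intros)
  then have "2 * (w \<bullet> w) \<le> 0 * c"
    by (rule tendsto_lowerbound) (auto intro: * eventually_mono[OF eventually_at_right_less])
  then have "w \<bullet> w \<le> 0" by simp
  then have "w = 0" by (metis inner_gt_zero_iff not_le)
  then show ?thesis using that[OF xS nx, of ?l] by (simp add: w_def)
qed

text \<open>Induction on the dimension: split off one unit eigenvector. Self-adjointness makes its
  orthogonal complement within \<open>S\<close> invariant again, and this complement has smaller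
  dimension.\<close>

lemma selfadjoint_eigenbasis:
  fixes T :: "'a::euclidean_space \<Rightarrow> 'a"
  assumes T: "linear T" and adj: "\<And>x y. T x \<bullet> y = x \<bullet> T y"
    and "subspace S" "T ` S \<subseteq> S"
  shows "\<exists>B. finite B \<and> pairwise orthogonal B \<and> (\<forall>b\<in>B. norm b = 1 \<and> (\<exists>l. T b = l *\<^sub>R b))
    \<and> span B = S"
  using assms(3,4)
proof (induction "dim S" arbitrary: S rule: less_induct)
  case less
  show ?case
  proof (cases "S = {0}")
    case True
    then show ?thesis by (intro exI[of _ "{}"]) auto
  next
    case False
    obtain x l where x: "x \<in> S" "norm x = 1" "T x = l *\<^sub>R x"
      using selfadjoint_eigenvector[OF T adj less.prems False] by blast
    let ?S = "{y \<in> S. x \<bullet> y = 0}"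
    have sub: "subspace ?S"
      using less.prems(1) by (auto simp: subspace_def inner_add_right)
    have inv: "T ` ?S \<subseteq> ?S"
    proof clarify
      fix y assume y: "y \<in> S" "x \<bullet> y = 0"
      have "x \<bullet> T y = l * (x \<bullet> y)"
        using x(3) by (simp flip: adj)
      then show "T y \<in> S \<and> x \<bullet> T y = 0" using y less.prems(2) by auto
    qed
    have xx: "x \<bullet> x = 1" using x(2) by (simp add: norm_eq_1)
    have "?S \<subset> S" using x(1) xx by force
    then have "dim ?S < dim S"
      by (metis (no_types, lifting) dim_psubset less.prems(1) span_eq_iff sub)
    from less.hyps[OF this sub inv] obtain B where
      B: "finite B" "pairwise orthogonal B" "\<forall>b\<in>B. norm b = 1 \<and> (\<exists>l. T b = l *\<^sub>R b)" "span B = ?S"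
      by blast
    have orth: "x \<bullet> b = 0" if "b \<in> B" for b
      using B(4) that span_superset by blast
    have "span (insert x B) = S"
    proof
      show "span (insert x B) \<subseteq> S"
        using B(4) x(1) less.prems(1) span_superset[of B] by (intro span_minimal) auto
      show "S \<subseteq> span (insert x B)"
      proof
        fix y assume y: "y \<in> S"
        have "y - (x \<bullet> y) *\<^sub>R x \<in> span B"
          unfolding B(4) using x(1) y less.prems(1) xx
          by (simp add: inner_diff_right subspace_diff subspace_scale)
        then have "(y - (x \<bullet> y) *\<^sub>R x) + (x \<bullet> y) *\<^sub>R x \<in> span (insert x B)"
          by (intro span_add span_scale) (auto intro: span_base subsetD[OF span_mono])
        then show "y \<in> span (insert x B)" by simp
      qed
    qed
    moreover have "pairwise orthogonal (insert x B)"
      using B(2) orth by (auto simp: pairwise_insert orthogonal_def inner_commute)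
    ultimately show ?thesis
      using B x by (intro exI[of _ "insert x B"]) auto
  qed
qed

text \<open>Since \<open>psd_sqrt\<close> is a choice, its properties hold once some root exists.
  The witness keeps an orthonormal eigenbasis of \<open>A\<close> and replaces each eigenvalue by
  its square root, which squares back because the eigenvalues are nonnegative.\<close>

lemma psd_sqrt_exists:
  fixes A :: "real^'k^'k"
  assumes sym: "transpose A = A" and psd: "\<And>v. 0 \<le> v \<bullet> (A *v v)"
  shows "transpose (psd_sqrt A) = psd_sqrt A" "psd_sqrt A ** psd_sqrt A = A"
proof -
  let ?T = "(*v) A"
  have adj: "(A *v x) \<bullet> y = x \<bullet> (A *v y)" for x y
    by (metis dot_lmul_matrix sym vector_transpose_matrix)
  obtain B where B: "finite B" "pairwise orthogonal B"
      "\<And>b. b \<in> B \<Longrightarrow> norm b = 1" "\<And>b. b \<in> B \<Longrightarrow> \<exists>l. A *v b = l *\<^sub>R b" "span B = UNIV"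
    using selfadjoint_eigenbasis[of ?T UNIV] adj by (auto simp: matrix_vector_mul_linear)
  \<comment> \<open>For a unit eigenvector \<open>b\<close> this is its eigenvalue; the formula
    avoids choosing eigenvalues separately.\<close>
  let ?l = "\<lambda>b. b \<bullet> (A *v b)"
  have bb: "b \<bullet> b' = (if b = b' then 1 else 0)" if "b \<in> B" "b' \<in> B" for b b'
    using B(2) B(3)[OF that(1)] that by (auto simp: pairwise_def orthogonal_def norm_eq_1)
  have eig: "A *v b = ?l b *\<^sub>R b" if "b \<in> B" for b
    using B(4)[OF that] bb[OF that that] by auto
  let ?f = "\<lambda>v. \<Sum>b\<in>B. (sqrt (?l b) * (v \<bullet> b)) *\<^sub>R b"
  have lin: "linear ?f"
    by (rule linearI) (simp_all add: inner_add_left algebra_simps sum.distrib scaleR_sum_right)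
  define C where "C = matrix ?f"
  have C: "C *v v = ?f v" for v
    unfolding C_def by (rule matrix_vector_mul(2)[OF lin, THEN fun_cong])
  have dot: "(C *v x) \<bullet> y = (\<Sum>b\<in>B. sqrt (?l b) * (x \<bullet> b) * (y \<bullet> b))" for x y
    unfolding C inner_sum_left inner_scaleR_left by (simp add: inner_commute)
  have "(C *v x) \<bullet> y = x \<bullet> (C *v y)" for x y
    unfolding inner_commute[of x] dot by (simp add: mult.commute mult.left_commute)
  then have "transpose C *v x = C *v x" for x
    by (metis (no_types) dot_lmul_matrix vector_eq_ldot vector_transpose_matrix transpose_transpose)
  then have symC: "transpose C = C" by (simp add: matrix_eq)
  have psdC: "0 \<le> v \<bullet> (C *v v)" for v
    unfolding inner_commute[of v] dot using psd by (intro sum_nonneg) (simp add: mult.assoc)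
  have "C *v (C *v v) = A *v v" for v
  proof -
    have "(C *v v) \<bullet> b = sqrt (?l b) * (v \<bullet> b)" if "b \<in> B" for b
    proof -
      have "(C *v v) \<bullet> b = (\<Sum>b'\<in>B. if b' = b then sqrt (?l b') * (v \<bullet> b') else 0)"
        unfolding dot using that by (intro sum.cong) (auto simp: bb)
      then show ?thesis using that B(1) by simp
    qed
    then have "C *v (C *v v) = (\<Sum>b\<in>B. (?l b * (v \<bullet> b)) *\<^sub>R b)"
      unfolding C[of "C *v v"] using psd
      by (intro sum.cong) (auto simp: mult.assoc[symmetric])
    also have "\<dots> = (\<Sum>b\<in>B. A *v ((v \<bullet> b) *\<^sub>R b))"
    proof (intro sum.cong refl)
      fix b assume "b \<in> B"
      then show "(?l b * (v \<bullet> b)) *\<^sub>R b = A *v ((v \<bullet> b) *\<^sub>R b)"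
        by (metis eig matrix_vector_mult_scaleR mult.commute scaleR_scaleR)
    qed
    also have "\<dots> = A *v (\<Sum>b\<in>B. (v \<bullet> b) *\<^sub>R b)"
      by (simp add: linear_sum[OF matrix_vector_mul_linear])
    also have "(\<Sum>b\<in>B. (v \<bullet> b) *\<^sub>R b) = v"
      using B by (intro orthonormal_basis_expand) auto
    finally show ?thesis .
  qed
  then have "C ** C = A" by (simp add: matrix_eq matrix_vector_mul_assoc)
  with symC psdC have "\<exists>B. transpose B = B \<and> (\<forall>v. 0 \<le> v \<bullet> (B *v v)) \<and> B ** B = A"
    by blast
  from someI_ex[OF this]
  show "transpose (psd_sqrt A) = psd_sqrt A" "psd_sqrt A ** psd_sqrt A = A"
    unfolding psd_sqrt_def by blast+
qed

text \<open>For a symmetric root \<open>B\<close> of \<open>A\<close> the form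
  \<open>v \<bullet> (A *v v)\<close> is the squared length of \<open>B *v v\<close>. Applied to the
  inverse Gram matrix, it yields the operator norm of the inverse square root in the final
  bound.\<close>

lemma psd_sqrt_quadratic_form:
  fixes A :: "real^'k^'k"
  assumes "transpose A = A" "\<And>v. 0 \<le> v \<bullet> (A *v v)"
  shows "v \<bullet> (A *v v) \<le> (onorm ((*v) (psd_sqrt A)) * norm v)\<^sup>2"
proof -
  let ?B = "psd_sqrt A"
  have "v \<bullet> (A *v v) = v \<bullet> (?B *v (?B *v v))"
    using psd_sqrt_exists(2)[OF assms] by (simp add: matrix_vector_mul_assoc)
  also have "\<dots> = (?B *v v) \<bullet> (?B *v v)"
    by (metis dot_lmul_matrix psd_sqrt_exists(1)[OF assms] vector_transpose_matrix)
  also have "\<dots> = (norm (?B *v v))\<^sup>2"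
    by (simp add: power2_norm_eq_inner)
  also have "\<dots> \<le> (onorm ((*v) ?B) * norm v)\<^sup>2"
    by (intro power_mono onorm matrix_vector_mul_bounded_linear) simp
  finally show ?thesis .
qed

section \<open>Least squares in the span of the basis functions\<close>

lemma l2_space_lin_comb:
  assumes "\<And>k. \<phi> k \<in> l2_space M"
  shows "(\<lambda>x. \<Sum>k\<in>UNIV. c k * \<phi> k x) \<in> l2_space M"
  using assms by (intro l2_space_sum l2_space_mult_left)

locale l2_basis =
  fixes M :: "'a measure" and \<phi> :: "'k::finite \<Rightarrow> 'a \<Rightarrow> real"
  assumes basis_l2: "\<And>k. \<phi> k \<in> l2_space M"
    and basis_independent: "l2_independent M \<phi>"
begin

definition lin_comb :: "real^'k \<Rightarrow> 'a \<Rightarrow> real" where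
  "lin_comb c x = (\<Sum>k\<in>UNIV. c $ k * \<phi> k x)"

text \<open>The right-hand side of the normal equations for approximating \<open>h\<close> in the
  span.\<close>

definition moments :: "('a \<Rightarrow> real) \<Rightarrow> real^'k" where
  "moments h = (\<chi> k. \<integral>x. h x * \<phi> k x \<partial>M)"

lemma lin_comb_l2: "lin_comb c \<in> l2_space M"
  unfolding lin_comb_def[abs_def] by (rule l2_space_lin_comb[OF basis_l2])

lemma lin_comb_diff: "lin_comb (c - d) x = lin_comb c x - lin_comb d x"
  by (simp add: lin_comb_def left_diff_distrib sum_subtractf)

lemma lin_comb_in_lin_span: "lin_comb c \<in> lin_span \<phi>"
  by (auto simp: lin_comb_def[abs_def] lin_span_def)

lemma lin_span_eq_range: "lin_span \<phi> = range lin_comb"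
proof
  show "lin_span \<phi> \<subseteq> range lin_comb"
  proof
    fix p assume "p \<in> lin_span \<phi>"
    then obtain c where "p = (\<lambda>x. \<Sum>k\<in>UNIV. c k * \<phi> k x)" by (auto simp: lin_span_def)
    then have "p = lin_comb (\<chi> k. c k)" by (simp add: lin_comb_def fun_eq_iff)
    then show "p \<in> range lin_comb" by blast
  qed
qed (use lin_comb_in_lin_span in blast)

lemma integral_mult_lin_comb:
  assumes h: "h \<in> l2_space M"
  shows "(\<integral>x. h x * lin_comb c x \<partial>M) = moments h \<bullet> c"
proof -
  have "(\<integral>x. h x * lin_comb c x \<partial>M) = (\<integral>x. (\<Sum>k\<in>UNIV. c $ k * (h x * \<phi> k x)) \<partial>M)"
    by (simp add: lin_comb_def sum_distrib_left ac_simps)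
  also have "\<dots> = (\<Sum>k\<in>UNIV. c $ k * (\<integral>x. h x * \<phi> k x \<partial>M))"
    using l2_space_integrable_mult[OF h basis_l2]
    by (subst Bochner_Integration.integral_sum) auto
  finally show ?thesis
    by (simp add: moments_def inner_vec_def mult.commute)
qed

lemma moments_lin_comb: "moments (lin_comb c) = gram M \<phi> *v c"
proof -
  have "(\<integral>x. lin_comb c x * \<phi> k x \<partial>M) = (\<Sum>j\<in>UNIV. (\<integral>x. \<phi> k x * \<phi> j x \<partial>M) * c $ j)" for k
    using integral_mult_lin_comb[OF basis_l2, of k c]
    by (simp add: moments_def inner_vec_def mult.commute)
  then show ?thesis
    by (simp add: moments_def gram_def matrix_vector_mult_def vec_eq_iff)
qed

lemma moments_diff:
  assumes "h \<in> l2_space M" "h' \<in> l2_space M"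
  shows "moments (\<lambda>x. h x - h' x) = moments h - moments h'"
  using l2_space_integrable_mult[OF assms(1) basis_l2] l2_space_integrable_mult[OF assms(2) basis_l2]
  by (simp add: moments_def vec_eq_iff left_diff_distrib)

lemma l2_norm_lin_comb_gram: "(l2_norm M (lin_comb c))\<^sup>2 = c \<bullet> (gram M \<phi> *v c)"
  using integral_mult_lin_comb[OF lin_comb_l2, of c c]
  unfolding l2_norm_power2 by (simp add: power2_eq_square moments_lin_comb inner_commute)

lemma transpose_gram: "transpose (gram M \<phi>) = gram M \<phi>"
  by (simp add: transpose_def gram_def mult.commute)

text \<open>A vector \<open>c\<close> in the kernel of the Gram matrix gives a combination of norm
  zero, hence one vanishing almost everywhere, and independence forces \<open>c = 0\<close>.\<close>

lemma gram_left_inverse: "matrix_inv (gram M \<phi>) ** gram M \<phi> = mat 1"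
  and gram_right_inverse: "gram M \<phi> ** matrix_inv (gram M \<phi>) = mat 1"
proof -
  have "c = 0" if "gram M \<phi> *v c = 0" for c
  proof -
    have "(\<integral>x. (lin_comb c x)\<^sup>2 \<partial>M) = 0"
      using l2_norm_lin_comb_gram[of c] that by (simp add: l2_norm_power2)
    then have "AE x in M. (lin_comb c x)\<^sup>2 = 0"
      using integral_nonneg_eq_0_iff_AE[OF l2_spaceD(2)[OF lin_comb_l2]] by simp
    then have "AE x in M. (\<Sum>k\<in>UNIV. c $ k * \<phi> k x) = 0"
      by (simp add: lin_comb_def)
    then show "c = 0"
      using basis_independent by (simp add: l2_independent_def vec_eq_iff)
  qed
  then have "invertible (gram M \<phi>)"
    by (metis invertible_left_inverse matrix_left_invertible_ker)
  then have "\<exists>A. gram M \<phi> ** A = mat 1 \<and> A ** gram M \<phi> = mat 1"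
    by (simp add: invertible_def)
  from someI_ex[OF this]
  show "matrix_inv (gram M \<phi>) ** gram M \<phi> = mat 1" "gram M \<phi> ** matrix_inv (gram M \<phi>) = mat 1"
    unfolding matrix_inv_def by auto
qed

lemma transpose_gram_inv: "transpose (matrix_inv (gram M \<phi>)) = matrix_inv (gram M \<phi>)"
  by (metis gram_left_inverse gram_right_inverse matrix_mul_assoc matrix_mul_lid matrix_mul_rid
      matrix_transpose_mul transpose_gram transpose_mat)

lemma gram_mult_inv: "gram M \<phi> *v (matrix_inv (gram M \<phi>) *v v) = v"
  by (simp add: matrix_vector_mul_assoc gram_right_inverse)

text \<open>Substituting the coefficients that solve the normal equations turns the Gram form into
  the form of its inverse. For this reason the noise is governed by the inverse square root and not
  by the full inverse.\<close>

lemma l2_norm_lin_comb_inv: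
  "(l2_norm M (lin_comb (matrix_inv (gram M \<phi>) *v v)))\<^sup>2 = v \<bullet> (matrix_inv (gram M \<phi>) *v v)"
  by (simp add: l2_norm_lin_comb_gram gram_mult_inv inner_commute)

lemma l2_norm_lin_comb_inv_le:
  "l2_norm M (lin_comb (matrix_inv (gram M \<phi>) *v v))
     \<le> onorm ((*v) (psd_sqrt (matrix_inv (gram M \<phi>)))) * norm v"
proof (rule power2_le_imp_le)
  show "(l2_norm M (lin_comb (matrix_inv (gram M \<phi>) *v v)))\<^sup>2
      \<le> (onorm ((*v) (psd_sqrt (matrix_inv (gram M \<phi>)))) * norm v)\<^sup>2"
    unfolding l2_norm_lin_comb_inv
    \<comment> \<open>The inverse Gram matrix is positive semidefinite because its quadratic form is
      the squared norm just computed.\<close>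
    by (rule psd_sqrt_quadratic_form[OF transpose_gram_inv]) (simp flip: l2_norm_lin_comb_inv)
qed (simp add: onorm_pos_le matrix_vector_mul_bounded_linear)

text \<open>Orthogonality of the residual to the whole span thereby amounts to the normal equations
  for \<open>d\<close>.\<close>

lemma lin_comb_projection_orthogonal:
  assumes h: "h \<in> l2_space M"
  shows "(\<integral>x. (h x - lin_comb d x) * lin_comb c x \<partial>M) = (moments h - gram M \<phi> *v d) \<bullet> c"
  using integral_mult_lin_comb[OF l2_space_diff[OF h lin_comb_l2]]
  by (simp add: moments_diff[OF h lin_comb_l2] moments_lin_comb)

text \<open>The solution of the normal equations shows that the choice in \<open>l2_proj\<close> has
  a candidate. Conversely, whichever candidate is chosen satisfies these equations, and
  invertibility of the Gram matrix fixes its coefficients.\<close>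

lemma l2_proj_eq:
  assumes h: "h \<in> l2_space M"
  shows "l2_proj M \<phi> h = lin_comb (matrix_inv (gram M \<phi>) *v moments h)"
proof -
  let ?P = "\<lambda>p. p \<in> lin_span \<phi> \<and> (\<forall>q\<in>lin_span \<phi>. (\<integral>x. (h x - p x) * q x \<partial>M) = 0)"
  have "?P (lin_comb (matrix_inv (gram M \<phi>) *v moments h))"
    by (auto simp: lin_span_eq_range lin_comb_projection_orthogonal[OF h] gram_mult_inv)
  then have "?P (l2_proj M \<phi> h)"
    unfolding l2_proj_def by (rule someI[where P = ?P])
  then obtain d where d: "l2_proj M \<phi> h = lin_comb d"
    and orth: "\<And>c. (\<integral>x. (h x - lin_comb d x) * lin_comb c x \<partial>M) = 0"
    by (auto simp: lin_span_eq_range)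
  \<comment> \<open>Testing orthogonality with the residual of the normal equations itself as
    coefficient vector shows that its squared length is zero.\<close>
  have "moments h = gram M \<phi> *v d"
    using orth[of "moments h - gram M \<phi> *v d"] by (simp add: lin_comb_projection_orthogonal[OF h])
  then have "d = matrix_inv (gram M \<phi>) *v moments h"
    by (simp add: matrix_vector_mul_assoc gram_left_inverse)
  with d show ?thesis by simp
qed

text \<open>The squared norm of the projection \<open>p\<close> is the inner product of
  \<open>h\<close> and \<open>p\<close>, so Cauchy-Schwarz allows one factor to be
  cancelled.\<close>

lemma l2_norm_projection_le:
  assumes h: "h \<in> l2_space M"
  shows "l2_norm M (lin_comb (matrix_inv (gram M \<phi>) *v moments h)) \<le> l2_norm M h"
proof -
  let ?p = "lin_comb (matrix_inv (gram M \<phi>) *v moments h)"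
  have "(l2_norm M ?p)\<^sup>2 = (\<integral>x. h x * ?p x \<partial>M)"
    by (simp add: l2_norm_lin_comb_inv integral_mult_lin_comb[OF h])
  also have "\<dots> \<le> l2_norm M h * l2_norm M ?p"
    using l2_norm_Cauchy_Schwarz[OF h lin_comb_l2] by (simp add: abs_le_iff)
  finally show ?thesis
    using l2_norm_nonneg[of M h] l2_norm_nonneg[of M ?p]
    by (cases "l2_norm M ?p = 0") (auto simp: power2_eq_square)
qed

text \<open>In the application \<open>a\<close> is the vector of empirical moments, \<open>h\<close>
  the estimated and \<open>v\<close> the true value function. By linearity the error is the sum of
  the regression of the noise \<open>a - moments h\<close>, the projection of \<open>h - v\<close>,
  which is a contraction, and the projection error of \<open>v\<close>.\<close>

lemma regression_error_le:
  assumes h: "h \<in> l2_space M" and v: "v \<in> l2_space M"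
  shows "l2_norm M (\<lambda>x. lin_comb (matrix_inv (gram M \<phi>) *v a) x - v x)
    \<le> onorm ((*v) (psd_sqrt (matrix_inv (gram M \<phi>)))) * norm (a - moments h)
      + l2_norm M (\<lambda>x. h x - v x) + l2_norm M (\<lambda>x. l2_proj M \<phi> v x - v x)"
proof -
  let ?G = "matrix_inv (gram M \<phi>)"
  let ?p1 = "lin_comb (?G *v (a - moments h))"
  let ?p2 = "lin_comb (?G *v moments (\<lambda>x. h x - v x))"
  let ?p3 = "\<lambda>x. l2_proj M \<phi> v x - v x"
  have p3: "?p3 \<in> l2_space M"
    unfolding l2_proj_eq[OF v] by (intro l2_space_diff lin_comb_l2 v)
  have "(\<lambda>x. lin_comb (?G *v a) x - v x) = (\<lambda>x. ?p1 x + ?p2 x + ?p3 x)"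
    by (simp add: l2_proj_eq[OF v] moments_diff[OF h v] matrix_vector_mult_diff_distrib lin_comb_diff)
  then have "l2_norm M (\<lambda>x. lin_comb (?G *v a) x - v x) = l2_norm M (\<lambda>x. ?p1 x + ?p2 x + ?p3 x)"
    by simp
  also have "\<dots> \<le> l2_norm M (\<lambda>x. ?p1 x + ?p2 x) + l2_norm M ?p3"
    by (intro l2_norm_triangle l2_space_add lin_comb_l2 p3)
  also have "\<dots> \<le> l2_norm M ?p1 + l2_norm M ?p2 + l2_norm M ?p3"
    by (intro add_right_mono l2_norm_triangle lin_comb_l2)
  also have "\<dots> \<le> onorm ((*v) (psd_sqrt ?G)) * norm (a - moments h)
      + l2_norm M (\<lambda>x. h x - v x) + l2_norm M ?p3"
    by (intro add_mono order_refl l2_norm_lin_comb_inv_le l2_norm_projection_le l2_space_diff h v)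
  finally show ?thesis .
qed

end

section \<open>Variance of Monte Carlo averages\<close>

text \<open>For the centred function \<open>H\<close>, independence removes the mixed products and
  leaves \<open>card I\<close> equal diagonal terms against a division by the square of
  \<open>card I\<close>. The variance is finally replaced by the larger second moment.\<close>

lemma (in prob_space) variance_Monte_Carlo_mean:
  fixes G :: "'a \<Rightarrow> real"
  assumes I: "finite I" "I \<noteq> {}" and G: "G \<in> l2_space M"
  shows "integrable (PiM I (\<lambda>_. M)) (\<lambda>\<omega>. ((\<Sum>i\<in>I. G (\<omega> i)) / card I - expectation G)\<^sup>2)"
    and "(\<integral>\<omega>. ((\<Sum>i\<in>I. G (\<omega> i)) / card I - expectation G)\<^sup>2 \<partial>PiM I (\<lambda>_. M))
      \<le> expectation (\<lambda>x. (G x)\<^sup>2) / card I"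
proof -
  interpret P: product_prob_space "\<lambda>_. M" I by standard
  let ?P = "PiM I (\<lambda>_. M)"
  have intG: "integrable M G" using G by (rule l2_space_imp_integrable)
  define H where "H x = G x - expectation G" for x
  have H: "H \<in> l2_space M"
    unfolding H_def[abs_def] by (intro l2_space_diff G l2_space_bounded) auto
  have intH: "integrable M H" using H by (rule l2_space_imp_integrable)
  have H0: "expectation H = 0"
    unfolding H_def using intG by (simp add: prob_space)
  have comp: "(\<lambda>\<omega>. H (\<omega> i)) \<in> l2_space ?P" if "i \<in> I" for i
    using H that
    by (subst l2_norm_distr(2)[where M' = M])
      (auto intro: distr_PiM_component prob_space_axioms l2_spaceD)
  have cross: "(\<integral>\<omega>. H (\<omega> i) * H (\<omega> j) \<partial>?P) = (if i = j then expectation (\<lambda>x. (H x)\<^sup>2) else 0)"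
    if ij: "i \<in> I" "j \<in> I" for i j
  proof (cases "i = j")
    case True
    have "(\<integral>\<omega>. (H (\<omega> i))\<^sup>2 \<partial>?P) = (\<integral>x. (H x)\<^sup>2 \<partial>distr ?P M (\<lambda>\<omega>. \<omega> i))"
      using ij l2_spaceD(1)[OF H] by (intro integral_distr[symmetric]) auto
    also have "distr ?P M (\<lambda>\<omega>. \<omega> i) = M"
      using ij by (intro distr_PiM_component prob_space_axioms)
    finally show ?thesis using True by (simp add: power2_eq_square)
  next
    case False
    \<comment> \<open>Filling the other coordinates with the constant 1 writes the mixed product as
      a product over all of \<open>I\<close>, whose integral factorises and has
      \<open>expectation H = 0\<close> among its factors.\<close>
    let ?f = "\<lambda>l. if l = i \<or> l = j then H else (\<lambda>_. 1)"
    have "(\<Prod>l\<in>I. ?f l (\<omega> l)) = H (\<omega> i) * H (\<omega> j)" for \<omega>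
    proof -
      have "(\<Prod>l\<in>I. ?f l (\<omega> l)) = (\<Prod>l\<in>{i, j}. H (\<omega> l))"
        using ij I(1) by (intro prod.mono_neutral_cong_right) auto
      then show ?thesis using False by simp
    qed
    then have "(\<integral>\<omega>. H (\<omega> i) * H (\<omega> j) \<partial>?P) = (\<integral>\<omega>. (\<Prod>l\<in>I. ?f l (\<omega> l)) \<partial>?P)"
      by simp
    also have "\<dots> = (\<Prod>l\<in>I. expectation (?f l))"
      using I(1) intH by (intro P.product_integral_prod) auto
    also have "\<dots> = 0"
      using ij I(1) H0 by (intro prod_zero) auto
    finally show ?thesis using False by simp
  qed
  have card: "real (card I) > 0" using I by (simp add: card_gt_0_iff)
  have eq: "((\<Sum>i\<in>I. G (\<omega> i)) / card I - expectation G)\<^sup>2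
      = (\<Sum>i\<in>I. \<Sum>j\<in>I. H (\<omega> i) * H (\<omega> j)) / (card I)\<^sup>2" for \<omega>
  proof -
    have "(\<Sum>i\<in>I. G (\<omega> i)) / card I - expectation G = (\<Sum>i\<in>I. H (\<omega> i)) / card I"
      using card by (simp add: H_def sum_subtractf field_simps)
    then show ?thesis
      by (simp add: power_divide power2_eq_square[of "sum _ _"] sum_product)
  qed
  have int: "integrable ?P (\<lambda>\<omega>. H (\<omega> i) * H (\<omega> j))" if "i \<in> I" "j \<in> I" for i j
    using that by (intro l2_space_integrable_mult comp)
  show "integrable ?P (\<lambda>\<omega>. ((\<Sum>i\<in>I. G (\<omega> i)) / card I - expectation G)\<^sup>2)"
    unfolding eq using int by (intro integrable_divide Bochner_Integration.integrable_sum)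
  have "(\<integral>\<omega>. ((\<Sum>i\<in>I. G (\<omega> i)) / card I - expectation G)\<^sup>2 \<partial>?P)
      = (\<Sum>i\<in>I. \<Sum>j\<in>I. \<integral>\<omega>. H (\<omega> i) * H (\<omega> j) \<partial>?P) / (card I)\<^sup>2"
    unfolding eq using int
    by (simp add: Bochner_Integration.integral_sum Bochner_Integration.integrable_sum)
  also have "(\<Sum>i\<in>I. \<Sum>j\<in>I. \<integral>\<omega>. H (\<omega> i) * H (\<omega> j) \<partial>?P) = card I * expectation (\<lambda>x. (H x)\<^sup>2)"
    using I(1) by (simp add: cross cong: sum.cong)
  also have "\<dots> / (card I)\<^sup>2 = expectation (\<lambda>x. (H x)\<^sup>2) / card I"
    using card by (simp add: power2_eq_square)
  also have "expectation (\<lambda>x. (H x)\<^sup>2) = expectation (\<lambda>x. (G x)\<^sup>2) - (expectation G)\<^sup>2"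
    unfolding H_def using intG l2_spaceD(2)[OF G] by (rule variance_eq)
  also have "(expectation (\<lambda>x. (G x)\<^sup>2) - (expectation G)\<^sup>2) / card I \<le> expectation (\<lambda>x. (G x)\<^sup>2) / card I"
    using card by (intro divide_right_mono) auto
  finally show "(\<integral>\<omega>. ((\<Sum>i\<in>I. G (\<omega> i)) / card I - expectation G)\<^sup>2 \<partial>?P)
      \<le> expectation (\<lambda>x. (G x)\<^sup>2) / card I" .
qed

section \<open>Norms on product spaces\<close>

text \<open>Fubini for the squared function; boundedness on a probability space supplies the
  integrability. This permits Minkowski's inequality to be used over the training points after the
  norm in the state has been taken.\<close>

lemma l2_norm_pair:
  assumes "prob_space P" "prob_space M"
    and h: "(\<lambda>(\<omega>, x). h \<omega> x) \<in> borel_measurable (P \<Otimes>\<^sub>M M)"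
    and bound: "\<And>\<omega> x. \<omega> \<in> space P \<Longrightarrow> x \<in> space M \<Longrightarrow> \<bar>h \<omega> x\<bar> \<le> C"
  shows "l2_norm P (\<lambda>\<omega>. l2_norm M (h \<omega>)) = l2_norm (P \<Otimes>\<^sub>M M) (\<lambda>(\<omega>, x). h \<omega> x)"
    and "(\<lambda>\<omega>. l2_norm M (h \<omega>)) \<in> l2_space P"
proof -
  interpret P: prob_space P by fact
  interpret M: prob_space M by fact
  interpret PM: pair_prob_space P M ..
  have hl2: "(\<lambda>(\<omega>, x). h \<omega> x) \<in> l2_space (P \<Otimes>\<^sub>M M)"
    using bound by (intro PM.l2_space_bounded[OF h]) (auto simp: space_pair_measure)
  have int: "integrable (P \<Otimes>\<^sub>M M) (\<lambda>(\<omega>, x). (h \<omega> x)\<^sup>2)"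
    using l2_spaceD(2)[OF hl2] by (simp add: split_beta')
  show "l2_norm P (\<lambda>\<omega>. l2_norm M (h \<omega>)) = l2_norm (P \<Otimes>\<^sub>M M) (\<lambda>(\<omega>, x). h \<omega> x)"
    using PM.integral_fst'[OF int]
    by (simp add: l2_norm_def split_beta')
  have "(\<lambda>(\<omega>, x). (h \<omega> x)\<^sup>2) \<in> borel_measurable (P \<Otimes>\<^sub>M M)"
    using int by (rule borel_measurable_integrable)
  then have "(\<lambda>\<omega>. \<integral>x. (h \<omega> x)\<^sup>2 \<partial>M) \<in> borel_measurable P"
    by (rule M.borel_measurable_lebesgue_integral)
  then have "(\<lambda>\<omega>. l2_norm M (h \<omega>)) \<in> borel_measurable P"
    unfolding l2_norm_def by simp
  moreover have "integrable P (\<lambda>\<omega>. (l2_norm M (h \<omega>))\<^sup>2)"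
    using PM.integrable_fst'[OF int] by (simp add: l2_norm_power2)
  ultimately show "(\<lambda>\<omega>. l2_norm M (h \<omega>)) \<in> l2_space P"
    by (rule l2_spaceI)
qed

lemma l2_norm_fst:
  assumes "prob_space P" "prob_space M" and h: "h \<in> borel_measurable P"
  shows "l2_norm (P \<Otimes>\<^sub>M M) (\<lambda>(\<omega>, x). h \<omega>) = l2_norm P h"
    and "(\<lambda>(\<omega>, x). h \<omega>) \<in> l2_space (P \<Otimes>\<^sub>M M) \<longleftrightarrow> h \<in> l2_space P"
proof -
  interpret M: prob_space M by fact
  have "distr (P \<Otimes>\<^sub>M M) P fst = P"
    by (rule M.distr_pair_fst)
  from l2_norm_distr[OF measurable_fst this h]
  show "l2_norm (P \<Otimes>\<^sub>M M) (\<lambda>(\<omega>, x). h \<omega>) = l2_norm P h"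
    "(\<lambda>(\<omega>, x). h \<omega>) \<in> l2_space (P \<Otimes>\<^sub>M M) \<longleftrightarrow> h \<in> l2_space P"
    by (simp_all add: split_beta')
qed

section \<open>Dependence on the training points\<close>

lemma V_hat_eq:
  "n < N \<Longrightarrow> V_hat N M U \<mu> r f g \<Gamma> \<phi> \<omega> n x = max (- \<Gamma>) (min \<Gamma>
     (SUP u\<in>U. approx_Q \<mu> r f \<phi> n (alpha_hat N M U \<mu> r f g \<Gamma> \<phi> \<omega> (Suc n)) x u))"
  by (subst V_hat.simps) (simp add: alpha_hat_def)

lemma V_hat_terminal: "V_hat N M U \<mu> r f g \<Gamma> \<phi> \<omega> N = g"
  by (subst V_hat.simps) simp

lemma V_tilde_eq:
  "n < N \<Longrightarrow> V_tilde N M U \<mu> r f g \<Gamma> \<phi> u_hat \<omega> n x =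
     f n x (u_hat n (alpha_hat N M U \<mu> r f g \<Gamma> \<phi> \<omega> (Suc n)) x)
     + (\<integral>y. V_tilde N M U \<mu> r f g \<Gamma> \<phi> u_hat \<omega> (Suc n) y
            * r n x (u_hat n (alpha_hat N M U \<mu> r f g \<Gamma> \<phi> \<omega> (Suc n)) x) y \<partial>\<mu>)"
  by (subst V_tilde.simps) (simp add: Let_def)

lemma V_tilde_terminal: "V_tilde N M U \<mu> r f g \<Gamma> \<phi> u_hat \<omega> N = g"
  by (subst V_tilde.simps) simp

lemma regression_coeff_cong:
  assumes "\<And>m. m \<in> {1..M} \<Longrightarrow> \<omega> (m, s) = \<omega>' (m, s)"
  shows "regression_coeff M \<mu> \<phi> \<omega> s h = regression_coeff M \<mu> \<phi> \<omega>' s h"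
proof -
  have "(\<Sum>m=1..M. h (\<omega> (m, s)) *\<^sub>R (\<chi> k. \<phi> k (\<omega> (m, s))))
      = (\<Sum>m=1..M. h (\<omega>' (m, s)) *\<^sub>R (\<chi> k. \<phi> k (\<omega>' (m, s))))"
    using assms by (intro sum.cong) simp_all
  then show ?thesis unfolding regression_coeff_def by (simp only:)
qed

text \<open>The estimate for time \<open>n\<close> is built from points for times
  \<open>n + 1\<close> and later. The one regressed at time \<open>n + 1\<close> therefore does not
  see the points used in that regression, which makes them a fresh sample.\<close>

lemma V_hat_cong:
  assumes "n \<le> N"
    and "\<And>m s. m \<in> {1..M} \<Longrightarrow> s \<in> {n+1..N} \<Longrightarrow> \<omega> (m, s) = \<omega>' (m, s)"
  shows "V_hat N M U \<mu> r f g \<Gamma> \<phi> \<omega> n = V_hat N M U \<mu> r f g \<Gamma> \<phi> \<omega>' n"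
  using assms
proof (induction n rule: inc_induct)
  case base
  show ?case by (simp add: V_hat_terminal)
next
  case (step n)
  have IH: "V_hat N M U \<mu> r f g \<Gamma> \<phi> \<omega> (Suc n) = V_hat N M U \<mu> r f g \<Gamma> \<phi> \<omega>' (Suc n)"
    using step.prems by (intro step.IH) auto
  have "alpha_hat N M U \<mu> r f g \<Gamma> \<phi> \<omega> (Suc n) = alpha_hat N M U \<mu> r f g \<Gamma> \<phi> \<omega>' (Suc n)"
    unfolding alpha_hat_def IH using step.hyps by (intro regression_coeff_cong step.prems) auto
  then show ?case
    using step.hyps by (simp add: V_hat_eq fun_eq_iff)
qed

lemma alpha_hat_cong:
  assumes "n < N"
    and "\<And>m s. m \<in> {1..M} \<Longrightarrow> s \<in> {n+1..N} \<Longrightarrow> \<omega> (m, s) = \<omega>' (m, s)"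
  shows "alpha_hat N M U \<mu> r f g \<Gamma> \<phi> \<omega> (Suc n) = alpha_hat N M U \<mu> r f g \<Gamma> \<phi> \<omega>' (Suc n)"
proof -
  have "V_hat N M U \<mu> r f g \<Gamma> \<phi> \<omega> (Suc n) = V_hat N M U \<mu> r f g \<Gamma> \<phi> \<omega>' (Suc n)"
    using assms by (intro V_hat_cong) auto
  then show ?thesis
    unfolding alpha_hat_def using assms(1)
    by (metis (no_types, lifting) assms(2) add.commute atLeastAtMost_iff less_eq_Suc_le order_refl
        plus_1_eq_Suc regression_coeff_cong)
qed

lemma V_tilde_cong:
  assumes "n \<le> N"
    and "\<And>m s. m \<in> {1..M} \<Longrightarrow> s \<in> {n+1..N} \<Longrightarrow> \<omega> (m, s) = \<omega>' (m, s)"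
  shows "V_tilde N M U \<mu> r f g \<Gamma> \<phi> u_hat \<omega> n = V_tilde N M U \<mu> r f g \<Gamma> \<phi> u_hat \<omega>' n"
  using assms
proof (induction n rule: inc_induct)
  case base
  show ?case by (simp add: V_tilde_terminal)
next
  case (step n)
  have IH: "V_tilde N M U \<mu> r f g \<Gamma> \<phi> u_hat \<omega> (Suc n) = V_tilde N M U \<mu> r f g \<Gamma> \<phi> u_hat \<omega>' (Suc n)"
    using step.prems by (intro step.IH) auto
  have "alpha_hat N M U \<mu> r f g \<Gamma> \<phi> \<omega> (Suc n) = alpha_hat N M U \<mu> r f g \<Gamma> \<phi> \<omega>' (Suc n)"
    using step.hyps by (intro alpha_hat_cong step.prems) auto
  then show ?case
    using step.hyps by (simp add: V_tilde_eq IH fun_eq_iff)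
qed

section \<open>Error propagation\<close>

lemma growth_factor_0: "growth_factor R 0 = 0"
  by (simp add: growth_factor_def)

text \<open>This is the recursion by which errors accumulate: a geometric sum inherited from value
  iteration, plus \<open>R\<close> times what the policy has lost at later times.\<close>

lemma growth_factor_Suc: "growth_factor R (Suc j) = (\<Sum>i\<le>j. R ^ i) + R * growth_factor R j"
proof (cases "R = 1")
  case True
  then show ?thesis by (simp add: growth_factor_def field_simps)
next
  case False
  then have nz: "R - 1 \<noteq> 0" by simp
  have "(\<Sum>i\<le>j. R ^ i) = (R ^ Suc j - 1) / (R - 1)"
    using geometric_sum[OF False, of "Suc j"] by (simp add: lessThan_Suc_atMost)
  also have "\<dots> = 1 / (R - 1)\<^sup>2 * ((R ^ Suc j - 1) * (R - 1))"
    using nz by (simp add: power2_eq_square)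
  finally have S: "(\<Sum>i\<le>j. R ^ i) = 1 / (R - 1)\<^sup>2 * ((R ^ Suc j - 1) * (R - 1))" .
  have "(R ^ Suc j - 1) * (R - 1) + R * (real j * R ^ (j + 1) - (real j + 1) * R ^ j + 1)
      = real (Suc j) * R ^ (Suc j + 1) - (real (Suc j) + 1) * R ^ Suc j + 1"
    by (simp add: algebra_simps)
  moreover have "c * a + R * (c * b) = c * (a + R * b)" for a b c :: real
    by (simp add: algebra_simps)
  ultimately show ?thesis
    unfolding S growth_factor_def using False by (simp only: if_False)
qed

text \<open>Every value of \<open>p\<close> is at most \<open>q v + d\<close>, and
  \<open>p v\<close> is within \<open>d\<close> of \<open>q v\<close>. The first bound also shows
  that \<open>p\<close> is bounded above, so that the real supremum is an upper bound.\<close>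

lemma abs_SUP_diff_le:
  fixes p q :: "'b \<Rightarrow> real"
  assumes v: "v \<in> U" and max: "\<And>u. u \<in> U \<Longrightarrow> q u \<le> q v"
    and close: "\<And>u. u \<in> U \<Longrightarrow> \<bar>q u - p u\<bar> \<le> d"
  shows "\<bar>q v - (SUP u\<in>U. p u)\<bar> \<le> d"
proof -
  have le: "p u \<le> q v + d" if "u \<in> U" for u
    using max[OF that] close[OF that] by linarith
  then have "(SUP u\<in>U. p u) \<le> q v + d"
    using v by (intro cSUP_least) auto
  moreover have "p v \<le> (SUP u\<in>U. p u)"
    using v le by (intro cSUP_upper bdd_aboveI2[where M = "q v + d"]) auto
  ultimately show ?thesis
    using close[OF v] by linarith
qed

text \<open>The process is represented by its transition density alone, and \<open>V\<close> by its
  bound, terminal value and dynamic programming equation. The control set is \<open>space C\<close>,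
  with \<open>C\<close> carrying its measurable structure; \<open>L\<close> is the number of
  training points per time step.\<close>

locale regress_later_policy = prob_space \<mu> + l2_basis \<mu> \<phi>
  for \<mu> :: "'x measure" and \<phi> :: "'k::finite \<Rightarrow> 'x \<Rightarrow> real" +
  fixes C :: "'u measure" and N L :: nat
    and r :: "nat \<Rightarrow> 'x \<Rightarrow> 'u \<Rightarrow> 'x \<Rightarrow> real" and R \<Gamma> :: real
    and f :: "nat \<Rightarrow> 'x \<Rightarrow> 'u \<Rightarrow> real" and g :: "'x \<Rightarrow> real"
    and V :: "nat \<Rightarrow> 'x \<Rightarrow> real"
    and u_hat :: "nat \<Rightarrow> real^'k \<Rightarrow> 'x \<Rightarrow> 'u"
  assumes L: "L \<ge> 1"
    and r_meas: "\<And>n. n < N \<Longrightarrow> (\<lambda>(x, u, y). r n x u y) \<in> borel_measurable (\<mu> \<Otimes>\<^sub>M C \<Otimes>\<^sub>M \<mu>)"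
    and r_total: "\<And>n x u. n < N \<Longrightarrow> x \<in> space \<mu> \<Longrightarrow> u \<in> space C \<Longrightarrow> (\<integral>y. r n x u y \<partial>\<mu>) = 1"
    and r_bound: "\<And>n x u y. n < N \<Longrightarrow> x \<in> space \<mu> \<Longrightarrow> u \<in> space C \<Longrightarrow> y \<in> space \<mu> \<Longrightarrow>
           0 \<le> r n x u y \<and> r n x u y \<le> R\<^sup>2"
    and R: "R > 0"
    and f_meas: "\<And>n. n < N \<Longrightarrow> (\<lambda>(x, u). f n x u) \<in> borel_measurable (\<mu> \<Otimes>\<^sub>M C)"
    and f_bounded: "\<exists>B. \<forall>n<N. \<forall>x\<in>space \<mu>. \<forall>u\<in>space C. \<bar>f n x u\<bar> \<le> B"
    and V_meas: "\<And>n. n \<le> N \<Longrightarrow> V n \<in> borel_measurable \<mu>"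
    and V_bound: "\<And>n x. n \<le> N \<Longrightarrow> x \<in> space \<mu> \<Longrightarrow> \<bar>V n x\<bar> \<le> \<Gamma>"
    and V_terminal: "\<And>x. x \<in> space \<mu> \<Longrightarrow> V N x = g x"
    and V_dynamic_programming: "\<And>n x. n < N \<Longrightarrow> x \<in> space \<mu> \<Longrightarrow>
           V n x = (SUP u\<in>space C. f n x u + (\<integral>y. V (Suc n) y * r n x u y \<partial>\<mu>))"
    and u_hat_meas: "\<And>n. n < N \<Longrightarrow>
           (\<lambda>(\<omega>, x). u_hat n (alpha_hat N L (space C) \<mu> r f g \<Gamma> \<phi> \<omega> (Suc n)) x)
             \<in> measurable (train_measure \<mu> N L (N - n)) C"
    and u_hat_argmax: "\<And>n \<omega> x u. n < N \<Longrightarrow> (\<omega>, x) \<in> space (train_measure \<mu> N L (N - n)) \<Longrightarrow>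
           u \<in> space C \<Longrightarrow>
           approx_Q \<mu> r f \<phi> n (alpha_hat N L (space C) \<mu> r f g \<Gamma> \<phi> \<omega> (Suc n)) x u
             \<le> approx_Q \<mu> r f \<phi> n (alpha_hat N L (space C) \<mu> r f g \<Gamma> \<phi> \<omega> (Suc n)) x
                  (u_hat n (alpha_hat N L (space C) \<mu> r f g \<Gamma> \<phi> \<omega> (Suc n)) x)"
begin

abbreviation "Vh \<equiv> V_hat N L (space C) \<mu> r f g \<Gamma> \<phi>"
abbreviation "\<alpha> \<equiv> alpha_hat N L (space C) \<mu> r f g \<Gamma> \<phi>"
abbreviation "Vt \<equiv> V_tilde N L (space C) \<mu> r f g \<Gamma> \<phi> u_hat"
abbreviation "P \<equiv> PiM ({1..L} \<times> {1..N}) (\<lambda>_. \<mu>)"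
abbreviation "PJ n \<equiv> PiM ({1..L} \<times> {n+1..N}) (\<lambda>_. \<mu>)"
abbreviation "forget n \<omega> \<equiv> restrict \<omega> ({1..L} \<times> {n+1..N})"
abbreviation "u\<^sub>h \<omega> n x \<equiv> u_hat n (\<alpha> \<omega> (Suc n)) x"

section \<open>The policy as a function of the full training sample\<close>

lemma prob_space_samples: "prob_space (PiM I (\<lambda>_. \<mu>))"
  by (intro prob_space_PiM prob_space_axioms)

lemma train_measure_eq: "n \<le> N \<Longrightarrow> train_measure \<mu> N L (N - n) = PJ n \<Otimes>\<^sub>M \<mu>"
  by (simp add: train_measure_def)

lemma forget_measurable: "forget n \<in> measurable P (PJ n)"
  by (intro measurable_restrict_subset) auto

lemma \<alpha>_forget: "n < N \<Longrightarrow> \<alpha> (forget n \<omega>) (Suc n) = \<alpha> \<omega> (Suc n)"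
  by (rule alpha_hat_cong) auto

text \<open>The assumption speaks of the points after time \<open>n\<close> only; composing with
  \<open>forget n\<close> carries it over to the full sample, because the coefficients are unchanged
  by forgetting.\<close>

lemma policy_measurable:
  assumes "n < N"
  shows "(\<lambda>(\<omega>, x). u\<^sub>h \<omega> n x) \<in> measurable (P \<Otimes>\<^sub>M \<mu>) C"
proof -
  have "(\<lambda>(\<omega>, x). (forget n \<omega>, x)) \<in> measurable (P \<Otimes>\<^sub>M \<mu>) (PJ n \<Otimes>\<^sub>M \<mu>)"
    using forget_measurable[of n] by measurable
  from measurable_compose[OF this u_hat_meas[OF assms, unfolded train_measure_eq[OF less_imp_le[OF assms]]]]
  show ?thesis
    using assms by (simp add: split_beta' \<alpha>_forget[simplified])
qed

lemma policy_in_space: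
  assumes "n < N" "\<omega> \<in> space P" "x \<in> space \<mu>"
  shows "u\<^sub>h \<omega> n x \<in> space C"
  using measurable_space[OF policy_measurable[OF assms(1)], of "(\<omega>, x)"] assms(2,3)
  by (simp add: space_pair_measure)

lemma policy_argmax:
  assumes "n < N" "\<omega> \<in> space P" "x \<in> space \<mu>" "u \<in> space C"
  shows "approx_Q \<mu> r f \<phi> n (\<alpha> \<omega> (Suc n)) x u \<le> approx_Q \<mu> r f \<phi> n (\<alpha> \<omega> (Suc n)) x (u\<^sub>h \<omega> n x)"
proof -
  have "forget n \<omega> \<in> space (PJ n)"
    using measurable_space[OF forget_measurable assms(2)] .
  then have "(forget n \<omega>, x) \<in> space (train_measure \<mu> N L (N - n))"
    using assms by (simp add: train_measure_eq space_pair_measure)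
  from u_hat_argmax[OF assms(1) this assms(4)] show ?thesis
    by (simp only: \<alpha>_forget[OF assms(1)])
qed

section \<open>One-step expectations under the transition density\<close>

context
  fixes n x u
  assumes n: "n < N" and x: "x \<in> space \<mu>" and u: "u \<in> space C"
begin

lemma r_section_measurable: "r n x u \<in> borel_measurable \<mu>"
proof -
  have "(\<lambda>y. (x, u, y)) \<in> measurable \<mu> (\<mu> \<Otimes>\<^sub>M C \<Otimes>\<^sub>M \<mu>)"
    using x u by simp
  from measurable_compose[OF this r_meas[OF n]] show ?thesis by simp
qed

lemma r_section_l2: "r n x u \<in> l2_space \<mu>"
  using r_bound[OF n x u] by (intro l2_space_bounded[where C = "R\<^sup>2"] r_section_measurable) auto

text \<open>The square of the density is at most \<open>R\<^sup>2\<close> times the density, which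
  has integral one. The norm is thus bounded by \<open>R\<close> instead of
  \<open>R\<^sup>2\<close>.\<close>

lemma l2_norm_r_section: "l2_norm \<mu> (r n x u) \<le> R"
proof -
  have "(\<integral>y. (r n x u y)\<^sup>2 \<partial>\<mu>) \<le> (\<integral>y. R\<^sup>2 * r n x u y \<partial>\<mu>)"
    using r_bound[OF n x u] l2_spaceD(2)[OF r_section_l2] l2_space_imp_integrable[OF r_section_l2]
    by (intro integral_mono) (auto simp: power2_eq_square[of "r _ _ _ _"] intro: mult_right_mono)
  also have "\<dots> = R\<^sup>2"
    by (simp add: r_total[OF n x u])
  finally show ?thesis
    unfolding l2_norm_def using R by (intro real_le_lsqrt) auto
qed

lemma abs_integral_r_le:
  assumes "h \<in> l2_space \<mu>"
  shows "\<bar>\<integral>y. h y * r n x u y \<partial>\<mu>\<bar> \<le> R * l2_norm \<mu> h"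
proof -
  have "\<bar>\<integral>y. h y * r n x u y \<partial>\<mu>\<bar> \<le> l2_norm \<mu> h * l2_norm \<mu> (r n x u)"
    by (rule l2_norm_Cauchy_Schwarz[OF assms r_section_l2])
  also have "\<dots> \<le> l2_norm \<mu> h * R"
    by (intro mult_left_mono l2_norm_r_section l2_norm_nonneg)
  finally show ?thesis by (simp add: mult.commute)
qed

lemma integral_r_diff_le:
  assumes h: "h \<in> l2_space \<mu>" and h': "h' \<in> l2_space \<mu>"
  shows "\<bar>(\<integral>y. h y * r n x u y \<partial>\<mu>) - (\<integral>y. h' y * r n x u y \<partial>\<mu>)\<bar>
    \<le> R * l2_norm \<mu> (\<lambda>y. h y - h' y)"
  using abs_integral_r_le[OF l2_space_diff[OF h h']]
    l2_space_integrable_mult[OF h r_section_l2] l2_space_integrable_mult[OF h' r_section_l2]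
  by (simp add: left_diff_distrib)

text \<open>A probability density does not enlarge a uniform bound. This keeps \<open>Vt\<close>
  bounded through the backward recursion.\<close>

lemma abs_integral_r_bounded:
  assumes "h \<in> borel_measurable \<mu>" "\<And>y. y \<in> space \<mu> \<Longrightarrow> \<bar>h y\<bar> \<le> B"
  shows "\<bar>\<integral>y. h y * r n x u y \<partial>\<mu>\<bar> \<le> B"
proof -
  have h: "h \<in> l2_space \<mu>" using assms by (rule l2_space_bounded)
  have "\<bar>\<integral>y. h y * r n x u y \<partial>\<mu>\<bar> \<le> (\<integral>y. \<bar>h y * r n x u y\<bar> \<partial>\<mu>)"
    by (rule integral_abs_bound)
  also have "\<dots> \<le> (\<integral>y. B * r n x u y \<partial>\<mu>)"
  proof (rule integral_mono)
    show "integrable \<mu> (\<lambda>y. \<bar>h y * r n x u y\<bar>)"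
      by (intro integrable_abs l2_space_integrable_mult h r_section_l2)
    show "integrable \<mu> (\<lambda>y. B * r n x u y)"
      by (intro integrable_mult_right l2_space_imp_integrable r_section_l2)
    show "\<bar>h y * r n x u y\<bar> \<le> B * r n x u y" if "y \<in> space \<mu>" for y
      using assms(2)[OF that] r_bound[OF n x u that] by (simp add: abs_mult mult_right_mono)
  qed
  finally show ?thesis by (simp add: r_total[OF n x u])
qed

text \<open>Sum and integral are exchanged: the estimated state-action value is the exact one-step
  expectation of the regression function. Its error thus comes from the regression alone.\<close>

lemma approx_Q_eq:
  "approx_Q \<mu> r f \<phi> n a x u = f n x u + (\<integral>y. lin_comb a y * r n x u y \<partial>\<mu>)"
proof -
  have "(\<integral>y. lin_comb a y * r n x u y \<partial>\<mu>) = (\<integral>y. (\<Sum>k\<in>UNIV. a $ k * (\<phi> k y * r n x u y)) \<partial>\<mu>)"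
    by (simp add: lin_comb_def sum_distrib_right mult.assoc)
  also have "\<dots> = (\<Sum>k\<in>UNIV. a $ k * basis_hat \<mu> r \<phi> n k x u)"
    using l2_space_integrable_mult[OF basis_l2 r_section_l2]
    by (subst Bochner_Integration.integral_sum) (auto simp: basis_hat_def)
  finally show ?thesis by (simp add: approx_Q_def)
qed

end

lemma V_l2: "n \<le> N \<Longrightarrow> V n \<in> l2_space \<mu>"
  using V_bound by (intro l2_space_bounded V_meas)

lemma \<Gamma>_nonneg: "0 \<le> \<Gamma>"
proof -
  obtain x where "x \<in> space \<mu>" using not_empty by blast
  from V_bound[OF order_refl this] show ?thesis by linarith
qed

section \<open>Pointwise error of one backward step\<close>

definition \<delta> :: "(nat \<times> nat \<Rightarrow> 'x) \<Rightarrow> nat \<Rightarrow> real" where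
  "\<delta> \<omega> n = R * l2_norm \<mu> (\<lambda>y. lin_comb (\<alpha> \<omega> (Suc n)) y - V (Suc n) y)"

context
  fixes n \<omega> x
  assumes n: "n < N" and \<omega>: "\<omega> \<in> space P" and x: "x \<in> space \<mu>"
begin

lemma approx_Q_error:
  assumes u: "u \<in> space C"
  shows "\<bar>approx_Q \<mu> r f \<phi> n (\<alpha> \<omega> (Suc n)) x u - (f n x u + (\<integral>y. V (Suc n) y * r n x u y \<partial>\<mu>))\<bar> \<le> \<delta> \<omega> n"
  using integral_r_diff_le[OF n x u lin_comb_l2 V_l2, of "Suc n"] n
  by (simp add: approx_Q_eq[OF n x u] \<delta>_def)

lemma approx_Q_policy_error:
  "\<bar>approx_Q \<mu> r f \<phi> n (\<alpha> \<omega> (Suc n)) x (u\<^sub>h \<omega> n x) - V n x\<bar> \<le> \<delta> \<omega> n"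
  unfolding V_dynamic_programming[OF n x]
  by (intro abs_SUP_diff_le policy_in_space policy_argmax approx_Q_error n \<omega> x)

text \<open>The policy attains the supremum. Replacing the supremum over a possibly uncountable set
  by one value lets joint measurability of \<open>Vh\<close> follow from that of the policy.\<close>

lemma V_hat_eq_policy:
  "Vh \<omega> n x = max (- \<Gamma>) (min \<Gamma> (approx_Q \<mu> r f \<phi> n (\<alpha> \<omega> (Suc n)) x (u\<^sub>h \<omega> n x)))"
proof -
  have "(SUP u\<in>space C. approx_Q \<mu> r f \<phi> n (\<alpha> \<omega> (Suc n)) x u)
      = approx_Q \<mu> r f \<phi> n (\<alpha> \<omega> (Suc n)) x (u\<^sub>h \<omega> n x)"
    using policy_in_space[OF n \<omega> x] policy_argmax[OF n \<omega> x]
    by (intro cSup_eq_maximum) auto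
  then show ?thesis by (simp add: V_hat_eq[OF n])
qed

text \<open>Truncation to the interval from \<open>- \<Gamma>\<close> to \<open>\<Gamma>\<close>
  cannot increase the distance to \<open>V n x\<close>, which lies in that interval.\<close>

lemma V_hat_error: "\<bar>Vh \<omega> n x - V n x\<bar> \<le> \<delta> \<omega> n"
  using approx_Q_policy_error V_bound[OF less_imp_le[OF n] x] V_hat_eq_policy
  by (auto simp: max_def min_def abs_le_iff split: if_splits)

text \<open>At the control chosen by the policy, the estimated state-action value is within
  \<open>\<delta> \<omega> n\<close> both of the true state-action value and of
  \<open>V n x\<close>, hence the factor 2. Replacing \<open>V\<close> by \<open>Vt\<close> under
  the transition integral costs the remaining term.\<close>

lemma V_tilde_error:
  assumes "Vt \<omega> (Suc n) \<in> l2_space \<mu>"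
  shows "\<bar>Vt \<omega> n x - V n x\<bar> \<le> 2 * \<delta> \<omega> n + R * l2_norm \<mu> (\<lambda>y. Vt \<omega> (Suc n) y - V (Suc n) y)"
  using integral_r_diff_le[OF n x policy_in_space[OF n \<omega> x] assms V_l2, of "Suc n"] n
    approx_Q_error[OF policy_in_space[OF n \<omega> x]] approx_Q_policy_error
  unfolding V_tilde_eq[OF n] by simp

end

section \<open>Joint measurability and boundedness in sample and state\<close>

lemma basis_hat_measurable:
  assumes "n < N"
  shows "(\<lambda>(x, u). basis_hat \<mu> r \<phi> n k x u) \<in> borel_measurable (\<mu> \<Otimes>\<^sub>M C)"
proof -
  have "(\<lambda>(p, y). (fst p, snd p, y)) \<in> measurable ((\<mu> \<Otimes>\<^sub>M C) \<Otimes>\<^sub>M \<mu>) (\<mu> \<Otimes>\<^sub>M C \<Otimes>\<^sub>M \<mu>)"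
    by measurable
  from measurable_compose[OF this r_meas[OF assms]]
  have "(\<lambda>(p, y). r n (fst p) (snd p) y) \<in> borel_measurable ((\<mu> \<Otimes>\<^sub>M C) \<Otimes>\<^sub>M \<mu>)"
    by (simp add: split_beta')
  then have "(\<lambda>(p, y). \<phi> k y * r n (fst p) (snd p) y) \<in> borel_measurable ((\<mu> \<Otimes>\<^sub>M C) \<Otimes>\<^sub>M \<mu>)"
    using measurable_compose[OF measurable_snd l2_spaceD(1)[OF basis_l2]]
    unfolding split_beta' by (rule borel_measurable_times[rotated])
  from borel_measurable_lebesgue_integral[OF this] show ?thesis
    by (simp add: basis_hat_def split_beta')
qed

lemma sample_point_measurable:
  "n < N \<Longrightarrow> m \<in> {1..L} \<Longrightarrow> (\<lambda>\<omega>. \<omega> (m, Suc n)) \<in> measurable P \<mu>"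
  by (intro measurable_component_singleton) auto

text \<open>The empirical counterpart of \<open>moments (Vh \<omega> (Suc n))\<close>.\<close>

definition sample_mean :: "(nat \<times> nat \<Rightarrow> 'x) \<Rightarrow> nat \<Rightarrow> real^'k" where
  "sample_mean \<omega> n =
     (\<chi> k. (\<Sum>m=1..L. Vh \<omega> (Suc n) (\<omega> (m, Suc n)) * \<phi> k (\<omega> (m, Suc n))) / real L)"

lemma \<alpha>_eq: "\<alpha> \<omega> (Suc n) = matrix_inv (gram \<mu> \<phi>) *v sample_mean \<omega> n"
proof -
  have "(1 / real L) *\<^sub>R (\<Sum>m=1..L. Vh \<omega> (Suc n) (\<omega> (m, Suc n)) *\<^sub>R (\<chi> k. \<phi> k (\<omega> (m, Suc n))))
      = sample_mean \<omega> n"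
    by (simp add: sample_mean_def vec_eq_iff)
  then show ?thesis by (simp only: alpha_hat_def regression_coeff_def)
qed

lemma sample_mean_measurable:
  assumes n: "n < N" and Vh: "(\<lambda>(\<omega>, x). Vh \<omega> (Suc n) x) \<in> borel_measurable (P \<Otimes>\<^sub>M \<mu>)"
  shows "(\<lambda>\<omega>. sample_mean \<omega> n $ k) \<in> borel_measurable P"
proof -
  have "(\<lambda>\<omega>. Vh \<omega> (Suc n) (\<omega> (m, Suc n)) * \<phi> k (\<omega> (m, Suc n))) \<in> borel_measurable P"
    if m: "m \<in> {1..L}" for m
  proof -
    note s = sample_point_measurable[OF n m]
    have "(\<lambda>\<omega>. (\<omega>, \<omega> (m, Suc n))) \<in> measurable P (P \<Otimes>\<^sub>M \<mu>)"
      using s by (intro measurable_Pair measurable_ident_sets refl)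
    from measurable_compose[OF this Vh] measurable_compose[OF s l2_spaceD(1)[OF basis_l2]]
    show ?thesis by simp
  qed
  then show ?thesis
    unfolding sample_mean_def
    by (simp only: vec_lambda_beta) (intro borel_measurable_divide borel_measurable_sum borel_measurable_const, auto)
qed

lemma \<alpha>_measurable:
  assumes "n < N" "(\<lambda>(\<omega>, x). Vh \<omega> (Suc n) x) \<in> borel_measurable (P \<Otimes>\<^sub>M \<mu>)"
  shows "(\<lambda>\<omega>. \<alpha> \<omega> (Suc n) $ k) \<in> borel_measurable P"
  unfolding \<alpha>_eq matrix_vector_mult_def vec_lambda_beta
  by (intro borel_measurable_sum borel_measurable_times borel_measurable_const
      sample_mean_measurable assms)

lemma g_measurable: "g \<in> borel_measurable \<mu>"
  using V_meas[OF order_refl] V_terminal by (simp cong: measurable_cong)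

lemma policy_pair_measurable:
  assumes "n < N"
  shows "(\<lambda>(\<omega>, x). (x, u\<^sub>h \<omega> n x)) \<in> measurable (P \<Otimes>\<^sub>M \<mu>) (\<mu> \<Otimes>\<^sub>M C)"
  using measurable_Pair[OF measurable_snd policy_measurable[OF assms]] by (simp add: split_beta')

lemma V_hat_measurable:
  assumes "n \<le> N"
  shows "(\<lambda>(\<omega>, x). Vh \<omega> n x) \<in> borel_measurable (P \<Otimes>\<^sub>M \<mu>)"
  using assms
proof (induction n rule: inc_induct)
  case base
  show ?case
    using measurable_compose[OF measurable_snd g_measurable] by (simp add: V_hat_terminal split_beta')
next
  case (step n)
  note p = policy_pair_measurable[OF step.hyps(2)]
  have q: "(\<lambda>(\<omega>, x). approx_Q \<mu> r f \<phi> n (\<alpha> \<omega> (Suc n)) x (u\<^sub>h \<omega> n x)) \<in> borel_measurable (P \<Otimes>\<^sub>M \<mu>)"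
    unfolding approx_Q_def split_beta'
    using measurable_compose[OF p f_meas[OF step.hyps(2)]]
      measurable_compose[OF p basis_hat_measurable[OF step.hyps(2)]]
      measurable_compose[OF measurable_fst \<alpha>_measurable[OF step.hyps(2) step.IH]]
    by (intro borel_measurable_add borel_measurable_sum borel_measurable_times)
      (simp_all add: split_beta')
  have "(\<lambda>(\<omega>, x). Vh \<omega> n x) \<in> borel_measurable (P \<Otimes>\<^sub>M \<mu>) \<longleftrightarrow>
      (\<lambda>(\<omega>, x). max (- \<Gamma>) (min \<Gamma> (approx_Q \<mu> r f \<phi> n (\<alpha> \<omega> (Suc n)) x (u\<^sub>h \<omega> n x))))
        \<in> borel_measurable (P \<Otimes>\<^sub>M \<mu>)"
    using step.hyps(2)
    by (intro measurable_cong) (auto simp: space_pair_measure V_hat_eq_policy simp del: One_nat_def)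
  also have "\<dots>"
    using q by (simp add: split_beta')
  finally show ?case .
qed

text \<open>At the terminal time nothing is truncated, and the bound is inherited from
  \<open>V N = g\<close>; at earlier times it is the truncation.\<close>

lemma V_hat_bounded:
  assumes "n \<le> N" "x \<in> space \<mu>"
  shows "\<bar>Vh \<omega> n x\<bar> \<le> \<Gamma>"
proof (cases "n = N")
  case True
  then show ?thesis using V_bound[OF order_refl assms(2)] V_terminal[OF assms(2)]
    by (simp add: V_hat_terminal)
next
  case False
  then show ?thesis using assms(1) \<Gamma>_nonneg by (simp add: V_hat_eq abs_le_iff)
qed

lemma V_tilde_measurable:
  assumes "n \<le> N"
  shows "(\<lambda>(\<omega>, x). Vt \<omega> n x) \<in> borel_measurable (P \<Otimes>\<^sub>M \<mu>)"
  using assms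
proof (induction n rule: inc_induct)
  case base
  show ?case
    using measurable_compose[OF measurable_snd g_measurable] by (simp add: V_tilde_terminal split_beta')
next
  case (step n)
  note p = policy_pair_measurable[OF step.hyps(2)]
  \<comment> \<open>The pair \<open>q\<close> of sample and current state is the parameter, and the
    next state \<open>y\<close> is the variable to be integrated out.\<close>
  have "(\<lambda>(q, y). (fst q, y)) \<in> measurable ((P \<Otimes>\<^sub>M \<mu>) \<Otimes>\<^sub>M \<mu>) (P \<Otimes>\<^sub>M \<mu>)"
    by measurable
  from measurable_compose[OF this step.IH]
  have 1: "(\<lambda>(q, y). Vt (fst q) (Suc n) y) \<in> borel_measurable ((P \<Otimes>\<^sub>M \<mu>) \<Otimes>\<^sub>M \<mu>)"
    by (simp add: split_beta')
  have "(\<lambda>(q, y). (snd q, u\<^sub>h (fst q) n (snd q), y)) \<in> measurable ((P \<Otimes>\<^sub>M \<mu>) \<Otimes>\<^sub>M \<mu>) (\<mu> \<Otimes>\<^sub>M C \<Otimes>\<^sub>M \<mu>)"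
    unfolding split_beta'
    using measurable_compose[OF measurable_fst policy_measurable[OF step.hyps(2)]]
    by (intro measurable_Pair measurable_snd measurable_compose[OF measurable_fst measurable_snd])
      (simp add: split_beta')
  from measurable_compose[OF this r_meas[OF step.hyps(2)]] 1
  have "(\<lambda>(q, y). Vt (fst q) (Suc n) y * r n (snd q) (u\<^sub>h (fst q) n (snd q)) y)
      \<in> borel_measurable ((P \<Otimes>\<^sub>M \<mu>) \<Otimes>\<^sub>M \<mu>)"
    by (simp add: split_beta')
  from borel_measurable_lebesgue_integral[OF this]
  show ?case
    using measurable_compose[OF p f_meas[OF step.hyps(2)]] step.hyps(2)
    by (simp add: V_tilde_eq split_beta')
qed

lemma section_measurable:
  assumes "(\<lambda>(\<omega>, x). h \<omega> x) \<in> borel_measurable (P \<Otimes>\<^sub>M \<mu>)" "\<omega> \<in> space P"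
  shows "h \<omega> \<in> borel_measurable \<mu>"
  using measurable_Pair2[OF assms] by simp

text \<open>The performance is not truncated, so its bound grows by a bound on \<open>f\<close> at
  each backward step. Its size is immaterial: its existence gives the square integrability used
  below.\<close>

lemma V_tilde_bounded:
  assumes "n \<le> N"
  shows "\<exists>B. \<forall>\<omega>\<in>space P. \<forall>x\<in>space \<mu>. \<bar>Vt \<omega> n x\<bar> \<le> B"
  using assms
proof (induction n rule: inc_induct)
  case base
  show ?case
    using V_bound[OF order_refl] V_terminal by (auto simp: V_tilde_terminal)
next
  case (step n)
  obtain B where B: "\<forall>\<omega>\<in>space P. \<forall>x\<in>space \<mu>. \<bar>Vt \<omega> (Suc n) x\<bar> \<le> B"
    using step.IH by blast
  obtain B' where B': "\<forall>n<N. \<forall>x\<in>space \<mu>. \<forall>u\<in>space C. \<bar>f n x u\<bar> \<le> B'"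
    using f_bounded by blast
  have "\<bar>Vt \<omega> n x\<bar> \<le> B' + B" if \<omega>: "\<omega> \<in> space P" and x: "x \<in> space \<mu>" for \<omega> x
  proof -
    note u = policy_in_space[OF step.hyps(2) \<omega> x]
    have "\<bar>\<integral>y. Vt \<omega> (Suc n) y * r n x (u\<^sub>h \<omega> n x) y \<partial>\<mu>\<bar> \<le> B"
      using step.hyps(2) \<omega> x u B
      by (intro abs_integral_r_bounded section_measurable[OF V_tilde_measurable]) auto
    moreover have "\<bar>f n x (u\<^sub>h \<omega> n x)\<bar> \<le> B'"
      using B' step.hyps(2) x u by blast
    ultimately show ?thesis unfolding V_tilde_eq[OF step.hyps(2)] by linarith
  qed
  then show ?case by blast
qed

section \<open>Variance of the empirical moments\<close>

definition sampling_error :: "(nat \<times> nat \<Rightarrow> 'x) \<Rightarrow> nat \<Rightarrow> real^'k" where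
  "sampling_error \<omega> n = sample_mean \<omega> n - moments (Vh \<omega> (Suc n))"

lemma sampling_error_measurable:
  assumes n: "n < N"
  shows "(\<lambda>\<omega>. sampling_error \<omega> n $ k) \<in> borel_measurable P"
proof -
  have Vh: "(\<lambda>(\<omega>, x). Vh \<omega> (Suc n) x) \<in> borel_measurable (P \<Otimes>\<^sub>M \<mu>)"
    using n by (intro V_hat_measurable) simp
  then have "(\<lambda>(\<omega>, x). Vh \<omega> (Suc n) x * \<phi> k x) \<in> borel_measurable (P \<Otimes>\<^sub>M \<mu>)"
    using measurable_compose[OF measurable_snd l2_spaceD(1)[OF basis_l2]]
    unfolding split_beta' by (rule borel_measurable_times)
  from borel_measurable_lebesgue_integral[OF this] sample_mean_measurable[OF n Vh]
  show ?thesis by (simp add: sampling_error_def moments_def)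
qed

text \<open>The estimate \<open>V_hat \<omega> (n + 1)\<close> does not involve the training points for time \<open>n + 1\<close>, so
  conditionally on the other points the sampling error is that of a Monte Carlo mean.\<close>

lemma sampling_error_component:
  assumes n: "n < N"
  shows "integrable P (\<lambda>\<omega>. (sampling_error \<omega> n $ k)\<^sup>2)"
    and "(\<integral>\<omega>. (sampling_error \<omega> n $ k)\<^sup>2 \<partial>P) \<le> \<Gamma>\<^sup>2 * (l2_norm \<mu> (\<phi> k))\<^sup>2 / L"
proof -
  interpret PM: product_prob_space "\<lambda>_. \<mu>" UNIV by standard
  \<comment> \<open>\<open>S\<close> indexes the fresh training points for time
    \<open>n + 1\<close>, and \<open>I\<close> all the others; the expectation is taken over
    \<open>S\<close> first, with the points in \<open>I\<close> fixed.\<close>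
  define S where "S = {1..L} \<times> {Suc n}"
  define I where "I = {1..L} \<times> {1..N} - S"
  let ?b = "\<Gamma>\<^sup>2 * (l2_norm \<mu> (\<phi> k))\<^sup>2 / L"
  have IS: "{1..L} \<times> {1..N} = I \<union> S" using n by (auto simp: I_def S_def)
  have disj: "I \<inter> S = {}" and fin: "finite I" by (auto simp: I_def)
  have card: "card S = L" by (simp add: S_def)
  have S: "finite S" "S \<noteq> {}" using L by (auto simp: S_def)
  have inner: "(\<integral>\<^sup>+y. ennreal ((sampling_error (merge I S (x, y)) n $ k)\<^sup>2) \<partial>PiM S (\<lambda>_. \<mu>)) \<le> ennreal ?b"
    if x: "x \<in> space (PiM I (\<lambda>_. \<mu>))" for x
  proof -
    define h where "h = Vh x (Suc n)"
    have h: "Vh (merge I S (x, y)) (Suc n) = h" for y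
      unfolding h_def using n by (intro V_hat_cong) (auto simp: merge_def I_def S_def)
    \<comment> \<open>Any completion of \<open>x\<close> to a full sample will do here: it serves to
      read off measurability of \<open>h\<close> as a section of the jointly measurable
      estimate.\<close>
    obtain y\<^sub>0 where "y\<^sub>0 \<in> space (PiM S (\<lambda>_. \<mu>))"
      using prob_space.not_empty[OF prob_space_samples] by blast
    then have "merge I S (x, y\<^sub>0) \<in> space P"
      using x measurable_space[OF measurable_merge, of "(x, y\<^sub>0)" I "\<lambda>_. \<mu>" S]
      unfolding IS by (simp add: space_pair_measure)
    from section_measurable[OF V_hat_measurable this, of "Suc n"]
    have h_meas: "h \<in> borel_measurable \<mu>" using n by (simp only: h Suc_leI)
    have h_le: "\<bar>h y\<bar> \<le> \<Gamma>" if "y \<in> space \<mu>" for y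
      unfolding h_def using n that by (intro V_hat_bounded) auto
    let ?G = "\<lambda>y. h y * \<phi> k y"
    have G: "?G \<in> l2_space \<mu>" and "expectation (\<lambda>y. (?G y)\<^sup>2) \<le> \<Gamma>\<^sup>2 * (l2_norm \<mu> (\<phi> k))\<^sup>2"
      using l2_space_bounded_mult[OF h_meas h_le basis_l2] by (simp_all add: l2_norm_power2)
    then have le: "expectation (\<lambda>y. (?G y)\<^sup>2) / L \<le> ?b"
      by (intro divide_right_mono) auto
    have "sampling_error (merge I S (x, y)) n $ k = (\<Sum>i\<in>S. ?G (y i)) / card S - expectation ?G" for y
    proof -
      have "(\<Sum>m=1..L. ?G (merge I S (x, y) (m, Suc n))) = (\<Sum>m=1..L. ?G (y (m, Suc n)))"
        by (intro sum.cong) (auto simp: merge_def I_def S_def)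
      also have "\<dots> = (\<Sum>i\<in>S. ?G (y i))"
        by (intro sum.reindex_bij_witness[of _ fst "\<lambda>m. (m, Suc n)"]) (auto simp: S_def)
      finally show ?thesis
        unfolding card by (simp add: sampling_error_def sample_mean_def moments_def h)
    qed
    then have "(\<integral>\<^sup>+y. ennreal ((sampling_error (merge I S (x, y)) n $ k)\<^sup>2) \<partial>PiM S (\<lambda>_. \<mu>))
        = (\<integral>\<^sup>+y. ennreal (((\<Sum>i\<in>S. ?G (y i)) / card S - expectation ?G)\<^sup>2) \<partial>PiM S (\<lambda>_. \<mu>))"
      by (simp only:)
    also have "\<dots> = ennreal (\<integral>y. ((\<Sum>i\<in>S. ?G (y i)) / card S - expectation ?G)\<^sup>2 \<partial>PiM S (\<lambda>_. \<mu>))"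
      by (intro nn_integral_eq_integral variance_Monte_Carlo_mean(1) S G) auto
    also have "\<dots> \<le> ennreal ?b"
      using variance_Monte_Carlo_mean(2)[OF S G] le unfolding card by (intro ennreal_leI) linarith
    finally show ?thesis .
  qed
  interpret PI: prob_space "PiM I (\<lambda>_. \<mu>)" by (rule prob_space_samples)
  have meas: "(\<lambda>\<omega>. (sampling_error \<omega> n $ k)\<^sup>2) \<in> borel_measurable P"
    by (intro borel_measurable_power sampling_error_measurable n)
  \<comment> \<open>Iterating the nonnegative integral requires no prior integrability; the finite
    bound obtained in this way then proves it.\<close>
  have "(\<integral>\<^sup>+\<omega>. ennreal ((sampling_error \<omega> n $ k)\<^sup>2) \<partial>P)
      = (\<integral>\<^sup>+x. \<integral>\<^sup>+y. ennreal ((sampling_error (merge I S (x, y)) n $ k)\<^sup>2)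
            \<partial>PiM S (\<lambda>_. \<mu>) \<partial>PiM I (\<lambda>_. \<mu>))"
    using meas unfolding IS by (intro PM.product_nn_integral_fold disj fin S(1)) simp
  also have "\<dots> \<le> (\<integral>\<^sup>+x. ennreal ?b \<partial>PiM I (\<lambda>_. \<mu>))"
    by (intro nn_integral_mono inner)
  also have "\<dots> = ennreal ?b"
    by (simp add: PI.emeasure_space_1)
  finally have le: "(\<integral>\<^sup>+\<omega>. ennreal ((sampling_error \<omega> n $ k)\<^sup>2) \<partial>P) \<le> ennreal ?b" .
  then show int: "integrable P (\<lambda>\<omega>. (sampling_error \<omega> n $ k)\<^sup>2)"
    using meas by (intro integrableI_nonneg) (auto simp: order_le_less_trans[OF _ ennreal_less_top])
  have "ennreal (\<integral>\<omega>. (sampling_error \<omega> n $ k)\<^sup>2 \<partial>P) \<le> ennreal ?b"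
    using le int by (subst nn_integral_eq_integral[symmetric]) auto
  then show "(\<integral>\<omega>. (sampling_error \<omega> n $ k)\<^sup>2 \<partial>P) \<le> ?b"
    by (subst (asm) ennreal_le_iff) auto
qed

text \<open>The squared length is the sum of one variance per basis function, each at most
  \<open>\<Gamma>\<^sup>2\<close> times the largest squared basis norm over \<open>L\<close>. The
  root of their number gives the factor \<open>sqrt (real CARD('k))\<close>.\<close>

lemma sampling_error_l2:
  assumes n: "n < N"
  shows "(\<lambda>\<omega>. norm (sampling_error \<omega> n)) \<in> l2_space P"
    and "l2_norm P (\<lambda>\<omega>. norm (sampling_error \<omega> n))
      \<le> sqrt (real CARD('k)) / sqrt (real L) * \<Gamma> * Max (range (\<lambda>k. l2_norm \<mu> (\<phi> k)))"
proof -
  let ?m = "Max (range (\<lambda>k. l2_norm \<mu> (\<phi> k)))"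
  have max: "l2_norm \<mu> (\<phi> k) \<le> ?m" for k by simp
  then have m0: "0 \<le> ?m" using l2_norm_nonneg order_trans by blast
  have eq: "(norm (sampling_error \<omega> n))\<^sup>2 = (\<Sum>k\<in>UNIV. (sampling_error \<omega> n $ k)\<^sup>2)" for \<omega>
    unfolding power2_norm_eq_inner by (simp add: inner_vec_def power2_eq_square)
  have norm_eq: "norm (sampling_error \<omega> n) = sqrt (\<Sum>k\<in>UNIV. (sampling_error \<omega> n $ k)\<^sup>2)" for \<omega>
    unfolding eq[symmetric] by simp
  show "(\<lambda>\<omega>. norm (sampling_error \<omega> n)) \<in> l2_space P"
  proof (rule l2_spaceI)
    show "(\<lambda>\<omega>. norm (sampling_error \<omega> n)) \<in> borel_measurable P"
      unfolding norm_eq using sampling_error_measurable[OF n] by simp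
    show "integrable P (\<lambda>\<omega>. (norm (sampling_error \<omega> n))\<^sup>2)"
      unfolding eq by (intro Bochner_Integration.integrable_sum sampling_error_component n)
  qed
  have "(\<integral>\<omega>. (norm (sampling_error \<omega> n))\<^sup>2 \<partial>P) = (\<Sum>k\<in>UNIV. \<integral>\<omega>. (sampling_error \<omega> n $ k)\<^sup>2 \<partial>P)"
    unfolding eq using sampling_error_component(1)[OF n] by (intro Bochner_Integration.integral_sum)
  also have "\<dots> \<le> (\<Sum>k\<in>(UNIV :: 'k set). \<Gamma>\<^sup>2 * ?m\<^sup>2 / L)"
  proof (rule sum_mono)
    fix k
    have "\<Gamma>\<^sup>2 * (l2_norm \<mu> (\<phi> k))\<^sup>2 / L \<le> \<Gamma>\<^sup>2 * ?m\<^sup>2 / L"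
      using power_mono[OF max l2_norm_nonneg, of k 2] by (intro divide_right_mono mult_left_mono) auto
    with sampling_error_component(2)[OF n, of k]
    show "(\<integral>\<omega>. (sampling_error \<omega> n $ k)\<^sup>2 \<partial>P) \<le> \<Gamma>\<^sup>2 * ?m\<^sup>2 / L" by linarith
  qed
  also have "\<dots> = (sqrt (real CARD('k)) / sqrt (real L) * \<Gamma> * ?m)\<^sup>2"
    by (simp add: power_mult_distrib power_divide)
  finally have le: "(l2_norm P (\<lambda>\<omega>. norm (sampling_error \<omega> n)))\<^sup>2
      \<le> (sqrt (real CARD('k)) / sqrt (real L) * \<Gamma> * ?m)\<^sup>2"
    by (simp only: l2_norm_power2)
  have "0 \<le> sqrt (real CARD('k)) / sqrt (real L) * \<Gamma> * ?m"
    by (intro mult_nonneg_nonneg divide_nonneg_nonneg m0 \<Gamma>_nonneg real_sqrt_ge_zero of_nat_0_le_iff)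
  with le show "l2_norm P (\<lambda>\<omega>. norm (sampling_error \<omega> n))
      \<le> sqrt (real CARD('k)) / sqrt (real L) * \<Gamma> * ?m"
    by (rule power2_le_imp_le)
qed

section \<open>Norms over training points and state\<close>

definition statistical_error :: real where
  "statistical_error = sqrt (real CARD('k)) / sqrt (real L) * \<Gamma>
     * onorm ((*v) (psd_sqrt (matrix_inv (gram \<mu> \<phi>)))) * Max (range (\<lambda>k. l2_norm \<mu> (\<phi> k)))"

definition approximation_error :: real where
  "approximation_error = Max ((\<lambda>s. l2_norm \<mu> (\<lambda>x. l2_proj \<mu> \<phi> (V s) x - V s x)) ` {1..N})"

definition V_hat_dist :: "nat \<Rightarrow> real" where
  "V_hat_dist n = l2_norm (P \<Otimes>\<^sub>M \<mu>) (\<lambda>(\<omega>, x). Vh \<omega> n x - V n x)"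

definition V_tilde_dist :: "nat \<Rightarrow> real" where
  "V_tilde_dist n = l2_norm (P \<Otimes>\<^sub>M \<mu>) (\<lambda>(\<omega>, x). Vt \<omega> n x - V n x)"

text \<open>A majorant of \<open>\<delta>\<close> split into noise, inherited error and projection
  error, so that Minkowski's inequality over the training points treats each summand
  separately.\<close>

definition \<delta>_bound :: "(nat \<times> nat \<Rightarrow> 'x) \<Rightarrow> nat \<Rightarrow> real" where
  "\<delta>_bound \<omega> n = R * (onorm ((*v) (psd_sqrt (matrix_inv (gram \<mu> \<phi>)))) * norm (sampling_error \<omega> n)
     + l2_norm \<mu> (\<lambda>x. Vh \<omega> (Suc n) x - V (Suc n) x) + approximation_error)"

lemma approximation_error_ge:
  "n < N \<Longrightarrow> l2_norm \<mu> (\<lambda>x. l2_proj \<mu> \<phi> (V (Suc n)) x - V (Suc n) x) \<le> approximation_error"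
  unfolding approximation_error_def by (intro Max_ge) auto

lemma V_hat_diff_measurable:
  "n \<le> N \<Longrightarrow> (\<lambda>(\<omega>, x). Vh \<omega> n x - V n x) \<in> borel_measurable (P \<Otimes>\<^sub>M \<mu>)"
  using V_hat_measurable[of n] measurable_compose[OF measurable_snd V_meas[of n]]
  unfolding split_beta' by (rule borel_measurable_diff)

lemma V_tilde_diff_measurable:
  "n \<le> N \<Longrightarrow> (\<lambda>(\<omega>, x). Vt \<omega> n x - V n x) \<in> borel_measurable (P \<Otimes>\<^sub>M \<mu>)"
  using V_tilde_measurable[of n] measurable_compose[OF measurable_snd V_meas[of n]]
  unfolding split_beta' by (rule borel_measurable_diff)

lemma V_hat_diff_l2:
  assumes "n \<le> N"
  shows "l2_norm P (\<lambda>\<omega>. l2_norm \<mu> (\<lambda>x. Vh \<omega> n x - V n x)) = V_hat_dist n"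
    and "(\<lambda>\<omega>. l2_norm \<mu> (\<lambda>x. Vh \<omega> n x - V n x)) \<in> l2_space P"
proof -
  have "\<bar>Vh \<omega> n x - V n x\<bar> \<le> 2 * \<Gamma>" if "\<omega> \<in> space P" "x \<in> space \<mu>" for \<omega> x
    using V_hat_bounded[OF assms that(2), of \<omega>] V_bound[OF assms that(2)] by linarith
  from l2_norm_pair[OF prob_space_samples prob_space_axioms V_hat_diff_measurable[OF assms] this]
  show "l2_norm P (\<lambda>\<omega>. l2_norm \<mu> (\<lambda>x. Vh \<omega> n x - V n x)) = V_hat_dist n"
    "(\<lambda>\<omega>. l2_norm \<mu> (\<lambda>x. Vh \<omega> n x - V n x)) \<in> l2_space P"
    by (simp_all add: V_hat_dist_def)
qed

lemma V_tilde_l2: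
  assumes "n \<le> N" "\<omega> \<in> space P"
  shows "Vt \<omega> n \<in> l2_space \<mu>"
proof -
  obtain B where "\<forall>\<omega>\<in>space P. \<forall>x\<in>space \<mu>. \<bar>Vt \<omega> n x\<bar> \<le> B"
    using V_tilde_bounded[OF assms(1)] by blast
  then show ?thesis
    using assms by (intro l2_space_bounded section_measurable[OF V_tilde_measurable]) auto
qed

lemma V_tilde_diff_bounded:
  assumes "n \<le> N"
  obtains B where "\<And>\<omega> x. \<omega> \<in> space P \<Longrightarrow> x \<in> space \<mu> \<Longrightarrow> \<bar>Vt \<omega> n x - V n x\<bar> \<le> B"
proof -
  obtain B where B: "\<forall>\<omega>\<in>space P. \<forall>x\<in>space \<mu>. \<bar>Vt \<omega> n x\<bar> \<le> B"
    using V_tilde_bounded[OF assms(1)] by blast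
  have "\<bar>Vt \<omega> n x - V n x\<bar> \<le> B + \<Gamma>" if "\<omega> \<in> space P" "x \<in> space \<mu>" for \<omega> x
    using B[rule_format, OF that] V_bound[OF assms that(2)] by linarith
  then show ?thesis by (rule that)
qed

lemma V_tilde_diff_l2:
  assumes "n \<le> N"
  shows "l2_norm P (\<lambda>\<omega>. l2_norm \<mu> (\<lambda>x. Vt \<omega> n x - V n x)) = V_tilde_dist n"
    and "(\<lambda>\<omega>. l2_norm \<mu> (\<lambda>x. Vt \<omega> n x - V n x)) \<in> l2_space P"
proof -
  obtain B where B: "\<And>\<omega> x. \<omega> \<in> space P \<Longrightarrow> x \<in> space \<mu> \<Longrightarrow> \<bar>Vt \<omega> n x - V n x\<bar> \<le> B"
    using V_tilde_diff_bounded[OF assms] by blast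
  from l2_norm_pair[OF prob_space_samples prob_space_axioms V_tilde_diff_measurable[OF assms] B]
  show "l2_norm P (\<lambda>\<omega>. l2_norm \<mu> (\<lambda>x. Vt \<omega> n x - V n x)) = V_tilde_dist n"
    "(\<lambda>\<omega>. l2_norm \<mu> (\<lambda>x. Vt \<omega> n x - V n x)) \<in> l2_space P"
    by (simp_all add: V_tilde_dist_def)
qed

lemma \<delta>_le_bound:
  assumes n: "n < N" and \<omega>: "\<omega> \<in> space P"
  shows "\<delta> \<omega> n \<le> \<delta>_bound \<omega> n"
proof -
  have "Vh \<omega> (Suc n) \<in> l2_space \<mu>"
    using n \<omega> by (intro l2_space_bounded[where C = \<Gamma>] section_measurable[OF V_hat_measurable] V_hat_bounded) auto
  from regression_error_le[OF this V_l2, of "Suc n" "sample_mean \<omega> n"]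
  show ?thesis
    using n approximation_error_ge[OF n] R
    unfolding \<delta>_def \<delta>_bound_def \<alpha>_eq sampling_error_def
    by (intro mult_left_mono) auto
qed

lemma \<delta>_bound_l2:
  assumes n: "n < N"
  shows "(\<lambda>\<omega>. \<delta>_bound \<omega> n) \<in> l2_space P"
    and "l2_norm P (\<lambda>\<omega>. \<delta>_bound \<omega> n)
      \<le> R * (V_hat_dist (Suc n) + (approximation_error + statistical_error))"
proof -
  interpret P: prob_space P by (rule prob_space_samples)
  let ?o = "onorm ((*v) (psd_sqrt (matrix_inv (gram \<mu> \<phi>))))"
  let ?a = "\<lambda>\<omega>. ?o * norm (sampling_error \<omega> n)"
  let ?b = "\<lambda>\<omega>. l2_norm \<mu> (\<lambda>x. Vh \<omega> (Suc n) x - V (Suc n) x)"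
  have a: "?a \<in> l2_space P"
    by (intro l2_space_mult_left sampling_error_l2 n)
  have b: "?b \<in> l2_space P"
    using n by (intro V_hat_diff_l2) simp
  have c: "(\<lambda>_. approximation_error) \<in> l2_space P"
    by (rule P.l2_space_bounded) auto
  show "(\<lambda>\<omega>. \<delta>_bound \<omega> n) \<in> l2_space P"
    unfolding \<delta>_bound_def by (intro l2_space_mult_left l2_space_add a b c)
  have o: "0 \<le> ?o" by (intro onorm_pos_le matrix_vector_mul_bounded_linear)
  have "l2_norm P ?a \<le> statistical_error"
    using mult_left_mono[OF sampling_error_l2(2)[OF n] o] o
    by (simp add: l2_norm_mult_left statistical_error_def mult.commute mult.left_commute)
  moreover have "l2_norm P ?b = V_hat_dist (Suc n)"
    using n by (intro V_hat_diff_l2) simp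
  \<comment> \<open>The norm of a constant is its absolute value; the approximation error is
    nonnegative because it dominates a norm.\<close>
  moreover have "l2_norm P (\<lambda>_. approximation_error) = approximation_error"
    using order_trans[OF l2_norm_nonneg approximation_error_ge[OF n]]
    by (simp add: l2_norm_const[OF prob_space_samples])
  moreover have "l2_norm P (\<lambda>\<omega>. ?a \<omega> + ?b \<omega> + approximation_error)
      \<le> l2_norm P (\<lambda>\<omega>. ?a \<omega> + ?b \<omega>) + l2_norm P (\<lambda>_. approximation_error)"
    by (intro l2_norm_triangle l2_space_add a b c)
  moreover have "l2_norm P (\<lambda>\<omega>. ?a \<omega> + ?b \<omega>) \<le> l2_norm P ?a + l2_norm P ?b"
    by (intro l2_norm_triangle a b)
  ultimately have "l2_norm P (\<lambda>\<omega>. ?a \<omega> + ?b \<omega> + approximation_error)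
      \<le> V_hat_dist (Suc n) + (approximation_error + statistical_error)"
    by linarith
  then show "l2_norm P (\<lambda>\<omega>. \<delta>_bound \<omega> n)
      \<le> R * (V_hat_dist (Suc n) + (approximation_error + statistical_error))"
    unfolding \<delta>_bound_def l2_norm_mult_left using R by simp
qed

text \<open>A majorant independent of the state has the same norm on the product as on the sample
  space, since the state has a law of total mass one.\<close>

lemma l2_norm_pair_le_fst:
  assumes "(\<lambda>(\<omega>, x). h \<omega> x) \<in> borel_measurable (P \<Otimes>\<^sub>M \<mu>)" "h' \<in> l2_space P"
    and "\<And>\<omega> x. \<omega> \<in> space P \<Longrightarrow> x \<in> space \<mu> \<Longrightarrow> \<bar>h \<omega> x\<bar> \<le> h' \<omega>"
  shows "l2_norm (P \<Otimes>\<^sub>M \<mu>) (\<lambda>(\<omega>, x). h \<omega> x) \<le> l2_norm P h'"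
proof -
  note fst = l2_norm_fst[OF prob_space_samples prob_space_axioms l2_spaceD(1)[OF assms(2)]]
  have "l2_norm (P \<Otimes>\<^sub>M \<mu>) (\<lambda>(\<omega>, x). h \<omega> x) \<le> l2_norm (P \<Otimes>\<^sub>M \<mu>) (\<lambda>(\<omega>, x). h' \<omega>)"
    using assms(3) by (intro l2_norm_mono assms(1) fst(2)[THEN iffD2, OF assms(2)]) (auto simp: space_pair_measure)
  then show ?thesis by (simp only: fst)
qed

lemma V_hat_dist_step:
  assumes n: "n < N"
  shows "V_hat_dist n \<le> R * (V_hat_dist (Suc n) + (approximation_error + statistical_error))"
proof -
  have "V_hat_dist n \<le> l2_norm P (\<lambda>\<omega>. \<delta>_bound \<omega> n)"
    unfolding V_hat_dist_def
  proof (rule l2_norm_pair_le_fst)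
    show "(\<lambda>(\<omega>, x). Vh \<omega> n x - V n x) \<in> borel_measurable (P \<Otimes>\<^sub>M \<mu>)"
      using n by (intro V_hat_diff_measurable) simp
    show "\<bar>Vh \<omega> n x - V n x\<bar> \<le> \<delta>_bound \<omega> n" if "\<omega> \<in> space P" "x \<in> space \<mu>" for \<omega> x
      using V_hat_error[OF n that] \<delta>_le_bound[OF n that(1)] by linarith
  qed (rule \<delta>_bound_l2[OF n])
  with \<delta>_bound_l2(2)[OF n] show ?thesis by linarith
qed

lemma V_tilde_dist_step:
  assumes n: "n < N"
  shows "V_tilde_dist n
    \<le> 2 * (R * (V_hat_dist (Suc n) + (approximation_error + statistical_error))) + R * V_tilde_dist (Suc n)"
proof -
  let ?t = "\<lambda>\<omega>. l2_norm \<mu> (\<lambda>y. Vt \<omega> (Suc n) y - V (Suc n) y)"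
  have t: "?t \<in> l2_space P" and t_norm: "l2_norm P ?t = V_tilde_dist (Suc n)"
    using n by (intro V_tilde_diff_l2; simp)+
  have d: "(\<lambda>\<omega>. 2 * \<delta>_bound \<omega> n) \<in> l2_space P" "(\<lambda>\<omega>. R * ?t \<omega>) \<in> l2_space P"
    by (intro l2_space_mult_left \<delta>_bound_l2 n t)+
  have "V_tilde_dist n \<le> l2_norm P (\<lambda>\<omega>. 2 * \<delta>_bound \<omega> n + R * ?t \<omega>)"
    unfolding V_tilde_dist_def
  proof (rule l2_norm_pair_le_fst)
    show "(\<lambda>(\<omega>, x). Vt \<omega> n x - V n x) \<in> borel_measurable (P \<Otimes>\<^sub>M \<mu>)"
      using n by (intro V_tilde_diff_measurable) simp
    show "\<bar>Vt \<omega> n x - V n x\<bar> \<le> 2 * \<delta>_bound \<omega> n + R * ?t \<omega>"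
      if "\<omega> \<in> space P" "x \<in> space \<mu>" for \<omega> x
      using V_tilde_error[OF n that V_tilde_l2[OF _ that(1)]] \<delta>_le_bound[OF n that(1)] n
      by simp
  qed (intro l2_space_add d)
  also have "\<dots> \<le> l2_norm P (\<lambda>\<omega>. 2 * \<delta>_bound \<omega> n) + l2_norm P (\<lambda>\<omega>. R * ?t \<omega>)"
    by (intro l2_norm_triangle d)
  also have "\<dots> = 2 * l2_norm P (\<lambda>\<omega>. \<delta>_bound \<omega> n) + R * V_tilde_dist (Suc n)"
    by (simp only: l2_norm_mult_left t_norm abs_of_pos[OF R] abs_numeral)
  finally show ?thesis
    using \<delta>_bound_l2(2)[OF n] by linarith
qed

section \<open>Solving the two recursions\<close>

lemma dist_terminal: "V_hat_dist N = 0" "V_tilde_dist N = 0"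
proof -
  have "l2_norm (P \<Otimes>\<^sub>M \<mu>) (\<lambda>(\<omega>, x). g x - V N x) = l2_norm (P \<Otimes>\<^sub>M \<mu>) (\<lambda>_. 0)"
    by (intro l2_norm_cong) (auto simp: space_pair_measure V_terminal)
  then show "V_hat_dist N = 0" "V_tilde_dist N = 0"
    by (simp_all add: V_hat_dist_def V_tilde_dist_def V_hat_terminal V_tilde_terminal l2_norm_def)
qed

text \<open>Adding the per-step error \<open>b\<close> to the distance gives a quantity that starts
  at \<open>b\<close> and in each backward step is at most \<open>b\<close> plus \<open>R\<close>
  times its successor. Its solution is a geometric sum.\<close>

lemma V_hat_dist_le:
  assumes "n \<le> N"
  shows "V_hat_dist n + (approximation_error + statistical_error)
    \<le> (\<Sum>i\<le>N - n. R ^ i) * (approximation_error + statistical_error)"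
  using assms
proof (induction n rule: inc_induct)
  case base
  show ?case by (simp add: dist_terminal)
next
  case (step n)
  let ?b = "approximation_error + statistical_error"
  have "V_hat_dist n \<le> R * ((\<Sum>i\<le>N - Suc n. R ^ i) * ?b)"
    using V_hat_dist_step[OF step.hyps(2)] mult_left_mono[OF step.IH] R by (meson less_imp_le order_trans)
  moreover have "(\<Sum>i\<le>N - n. R ^ i) = 1 + R * (\<Sum>i\<le>N - Suc n. R ^ i)"
    using step.hyps(2)
    by (simp add: Suc_diff_Suc[symmetric] sum.atMost_Suc_shift sum_distrib_left del: sum.atMost_Suc)
  ultimately show ?case by (simp add: algebra_simps)
qed

text \<open>Inserting the geometric bound into the one-step inequality for the performance yields,
  up to the factor \<open>2 * R\<close>, the recursion of \<open>growth_factor_Suc\<close>.\<close>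

lemma V_tilde_dist_le:
  assumes "n \<le> N"
  shows "V_tilde_dist n \<le> 2 * R * growth_factor R (N - n) * (approximation_error + statistical_error)"
  using assms
proof (induction n rule: inc_induct)
  case base
  show ?case by (simp add: dist_terminal growth_factor_0)
next
  case (step n)
  let ?b = "approximation_error + statistical_error"
  let ?S = "\<Sum>i\<le>N - Suc n. R ^ i" and ?G = "growth_factor R (N - Suc n)"
  have "V_tilde_dist n \<le> 2 * (R * (?S * ?b)) + R * (2 * R * ?G * ?b)"
  proof -
    have "R * (V_hat_dist (Suc n) + ?b) \<le> R * (?S * ?b)"
      using step.hyps(2) R by (intro mult_left_mono V_hat_dist_le) auto
    moreover have "R * V_tilde_dist (Suc n) \<le> R * (2 * R * ?G * ?b)"
      using step.IH R by (intro mult_left_mono) auto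
    ultimately show ?thesis using V_tilde_dist_step[OF step.hyps(2)] by linarith
  qed
  also have "\<dots> = 2 * R * (?S + R * ?G) * ?b"
    by (simp add: algebra_simps)
  also have "?S + R * ?G = growth_factor R (N - n)"
    using growth_factor_Suc[of R "N - Suc n"] step.hyps(2) by (simp add: Suc_diff_Suc)
  finally show ?case .
qed

section \<open>Passage to the training points after time \<open>n\<close>\<close>

lemma train_measure_distr:
  assumes "n \<le> N"
  shows "(\<lambda>(\<omega>, x). (forget n \<omega>, x)) \<in> measurable (P \<Otimes>\<^sub>M \<mu>) (train_measure \<mu> N L (N - n))"
    and "distr (P \<Otimes>\<^sub>M \<mu>) (train_measure \<mu> N L (N - n)) (\<lambda>(\<omega>, x). (forget n \<omega>, x))
      = train_measure \<mu> N L (N - n)"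
proof -
  interpret PM: product_prob_space "\<lambda>_. \<mu>" UNIV by standard
  show "(\<lambda>(\<omega>, x). (forget n \<omega>, x)) \<in> measurable (P \<Otimes>\<^sub>M \<mu>) (train_measure \<mu> N L (N - n))"
    unfolding train_measure_eq[OF assms] using forget_measurable[of n] by measurable
  \<comment> \<open>Dropping coordinates of a product of probability measures leaves the product
    over the remaining ones.\<close>
  have "distr P (PJ n) (forget n) = PJ n"
    by (intro PM.distr_restrict[symmetric]) auto
  moreover have "distr \<mu> \<mu> (\<lambda>x. x) = \<mu>"
    by (rule distr_id2) simp
  ultimately show "distr (P \<Otimes>\<^sub>M \<mu>) (train_measure \<mu> N L (N - n)) (\<lambda>(\<omega>, x). (forget n \<omega>, x))
      = train_measure \<mu> N L (N - n)"
    using pair_measure_distr[OF forget_measurable[of n] measurable_ident_sets[OF refl, of \<mu>]]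
      sigma_finite_measure_axioms
    unfolding train_measure_eq[OF assms] by simp
qed

text \<open>Only the coordinates kept by \<open>forget n\<close> matter, so the others may be filled with a fixed state.\<close>

lemma V_tilde_diff_train_measurable:
  assumes "n \<le> N"
  shows "(\<lambda>(\<omega>, x). Vt \<omega> n x - V n x) \<in> borel_measurable (train_measure \<mu> N L (N - n))"
proof -
  obtain x\<^sub>0 where x0: "x\<^sub>0 \<in> space \<mu>" using not_empty by blast
  let ?e = "\<lambda>\<omega>. \<lambda>i\<in>{1..L} \<times> {1..N}. if i \<in> {1..L} \<times> {n+1..N} then \<omega> i else x\<^sub>0"
  have "(\<lambda>\<omega>. if i \<in> {1..L} \<times> {n+1..N} then \<omega> i else x\<^sub>0) \<in> measurable (PJ n) \<mu>" for i
    by (cases "i \<in> {1..L} \<times> {n+1..N}") (simp_all add: x0 del: One_nat_def mem_Sigma_iff)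
  then have "?e \<in> measurable (PJ n) P"
    by (rule measurable_restrict)
  then have "(\<lambda>(\<omega>, x). (?e \<omega>, x)) \<in> measurable (PJ n \<Otimes>\<^sub>M \<mu>) (P \<Otimes>\<^sub>M \<mu>)"
    by measurable
  from measurable_compose[OF this V_tilde_diff_measurable[OF assms]]
  have "(\<lambda>(\<omega>, x). Vt (?e \<omega>) n x - V n x) \<in> borel_measurable (PJ n \<Otimes>\<^sub>M \<mu>)"
    by (simp only: split_beta' fst_conv snd_conv)
  moreover have "Vt (?e \<omega>) n = Vt \<omega> n" for \<omega>
    by (rule V_tilde_cong[OF assms]) auto
  ultimately show ?thesis
    by (simp only: train_measure_eq[OF assms])
qed

text \<open>The performance from time \<open>n\<close> on is unchanged by \<open>forget n\<close>,
  which preserves measure. The norm over all training points is therefore the norm over those after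
  time \<open>n\<close>.\<close>

lemma performance_bound:
  assumes n: "n \<le> N"
  shows "(\<lambda>(\<omega>, x). Vt \<omega> n x - V n x) \<in> l2_space (train_measure \<mu> N L (N - n)) \<and>
    l2_norm (train_measure \<mu> N L (N - n)) (\<lambda>(\<omega>, x). Vt \<omega> n x - V n x)
      \<le> 2 * R * growth_factor R (N - n) * (approximation_error + statistical_error)"
proof -
  interpret P: prob_space P by (rule prob_space_samples)
  interpret PM: pair_prob_space P \<mu> ..
  let ?h = "\<lambda>(\<omega>, x). Vt \<omega> n x - V n x"
  obtain B where B: "\<And>\<omega> x. \<omega> \<in> space P \<Longrightarrow> x \<in> space \<mu> \<Longrightarrow> \<bar>Vt \<omega> n x - V n x\<bar> \<le> B"
    using V_tilde_diff_bounded[OF n] by blast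
  have forget: "?h (case z of (\<omega>, x) \<Rightarrow> (forget n \<omega>, x)) = ?h z" for z
    using V_tilde_cong[OF n, of L "forget n (fst z)" "fst z" "space C" \<mu> r f g \<Gamma> \<phi> u_hat]
    by (simp add: split_beta')
  note D = l2_norm_distr[OF train_measure_distr[OF n] V_tilde_diff_train_measurable[OF n], unfolded forget]
  have "?h \<in> l2_space (P \<Otimes>\<^sub>M \<mu>)"
    using B by (intro PM.l2_space_bounded V_tilde_diff_measurable n) (auto simp: space_pair_measure)
  with D(2) V_tilde_dist_le[OF n] show ?thesis
    unfolding D(1)[symmetric] V_tilde_dist_def by simp
qed

end

section \<open>The controlled process\<close>

lemma prob_space_unif01: "prob_space unif01"
proof
  have "emeasure unif01 (space unif01) = emeasure lborel {0..1::real}"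
    unfolding unif01_def by (subst emeasure_restrict_space) (auto simp: space_restrict_space)
  then show "emeasure unif01 (space unif01) = 1" by simp
qed

lemma sets_unif01: "sets unif01 = sets (restrict_space borel {0..1})"
  unfolding unif01_def by (intro sets_restrict_space_cong) simp

text \<open>At time \<open>N\<close> no reward is summed and the state has not moved, so every
  control earns the constant \<open>g x\<close>. Some control must exist for the supremum to be this
  constant.\<close>

lemma value_fn_terminal:
  assumes "feedback_controls N D U \<noteq> {}"
  shows "value_fn N D U dyn f g N x = g x"
proof -
  interpret P: prob_space "PiM {..<N} (\<lambda>_. unif01)"
    by (intro prob_space_PiM prob_space_unif01)
  have "expected_reward N dyn f g u N x = g x" for u
    by (simp add: expected_reward_def P.prob_space)
  then show ?thesis
    using assms by (simp add: value_fn_def)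
qed

text \<open>The probabilities of the events \<open>d e \<in> A\<close> identify the law of
  \<open>d\<close> as the measure with density \<open>k\<close>; the claim is then a change of
  variables.\<close>

lemma integral_transition_density:
  fixes h :: "'x \<Rightarrow> real"
  assumes "prob_space \<nu>" "finite_measure \<mu>" and d: "d \<in> measurable \<nu> \<mu>"
    and k: "integrable \<mu> k" "\<And>y. y \<in> space \<mu> \<Longrightarrow> 0 \<le> k y"
    and density: "\<And>A. A \<in> sets \<mu> \<Longrightarrow> measure \<nu> {e \<in> space \<nu>. d e \<in> A} = (LINT y:A|\<mu>. k y)"
    and h: "h \<in> borel_measurable \<mu>"
  shows "(\<integral>e. h (d e) \<partial>\<nu>) = (\<integral>y. h y * k y \<partial>\<mu>)"
proof -
  interpret \<nu>: prob_space \<nu> by fact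
  have k_meas: "k \<in> borel_measurable \<mu>" using k(1) by (rule borel_measurable_integrable)
  have "distr \<nu> \<mu> d = density \<mu> k"
  proof (rule measure_eqI)
    fix A assume "A \<in> sets (distr \<nu> \<mu> d)"
    then have A: "A \<in> sets \<mu>" by simp
    have "emeasure (distr \<nu> \<mu> d) A = ennreal (measure \<nu> {e \<in> space \<nu>. d e \<in> A})"
      using A d by (simp add: emeasure_distr \<nu>.emeasure_eq_measure vimage_def Int_def conj_commute)
    also have "\<dots> = ennreal (\<integral>y. k y * indicator A y \<partial>\<mu>)"
      using density[OF A] by (simp add: set_lebesgue_integral_def mult.commute)
    also have "\<dots> = (\<integral>\<^sup>+y. ennreal (k y * indicator A y) \<partial>\<mu>)"
      using k A by (intro nn_integral_eq_integral[symmetric] integrable_real_mult_indicator AE_I2) auto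
    also have "\<dots> = emeasure (density \<mu> k) A"
      unfolding emeasure_density[OF measurable_compose[OF k_meas measurable_ennreal] A]
      by (intro nn_integral_cong) (simp split: split_indicator)
    finally show "emeasure (distr \<nu> \<mu> d) A = emeasure (density \<mu> k) A" .
  qed simp
  then have "(\<integral>e. h (d e) \<partial>\<nu>) = (\<integral>y. h y \<partial>density \<mu> k)"
    using integral_distr[OF d h] by simp
  also have "\<dots> = (\<integral>y. k y * h y \<partial>\<mu>)"
    using k k_meas h by (subst integral_density) auto
  finally show ?thesis by (simp add: mult.commute)
qed

theorem theorem2:
  fixes D :: "(real^'d) set" and U :: "(real^'q) set"
    and N M n :: nat
    and dyn :: "nat \<Rightarrow> real^'d \<Rightarrow> real \<Rightarrow> real^'q \<Rightarrow> real^'d"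
    and \<mu> :: "(real^'d) measure"
    and r :: "nat \<Rightarrow> real^'d \<Rightarrow> real^'q \<Rightarrow> real^'d \<Rightarrow> real" and R \<Gamma> :: real
    and f :: "nat \<Rightarrow> real^'d \<Rightarrow> real^'q \<Rightarrow> real" and g :: "real^'d \<Rightarrow> real"
    and \<phi> :: "'k::finite \<Rightarrow> real^'d \<Rightarrow> real"
    and u_hat :: "nat \<Rightarrow> real^'k \<Rightarrow> real^'d \<Rightarrow> real^'q"
  defines "V \<equiv> value_fn N D U dyn f g"
    and "\<alpha> \<equiv> alpha_hat N M U \<mu> r f g \<Gamma> \<phi>"
    and "Vt \<equiv> V_tilde N M U \<mu> r f g \<Gamma> \<phi> u_hat"
  assumes "N \<ge> 1" and "M \<ge> 1"
    and D: "D \<in> sets borel" and U: "compact U"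
    and dyn: "\<And>n. n < N \<Longrightarrow> (\<lambda>(x, e, u). dyn n x e u) \<in> measurable
           (restrict_space borel D \<Otimes>\<^sub>M restrict_space borel {0..1} \<Otimes>\<^sub>M restrict_space borel U)
           (restrict_space borel D)"
    and \<mu>: "prob_space \<mu>" "sets \<mu> = sets (restrict_space borel D)"
    and r_meas: "\<And>n. n < N \<Longrightarrow> (\<lambda>(x, u, y). r n x u y) \<in> borel_measurable
           (restrict_space borel D \<Otimes>\<^sub>M restrict_space borel U \<Otimes>\<^sub>M restrict_space borel D)"
    and r_density: "\<And>n x u A. n < N \<Longrightarrow> x \<in> D \<Longrightarrow> u \<in> U \<Longrightarrow> A \<in> sets \<mu> \<Longrightarrow>
           measure unif01 {e \<in> space unif01. dyn n x e u \<in> A} = (LINT y:A|\<mu>. r n x u y)"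
    and r_bound: "\<And>n x u y. n < N \<Longrightarrow> x \<in> D \<Longrightarrow> u \<in> U \<Longrightarrow> y \<in> D \<Longrightarrow>
           0 \<le> r n x u y \<and> r n x u y \<le> R\<^sup>2"
    and R: "R > 0"
    and f_meas: "\<And>n. n < N \<Longrightarrow>
           (\<lambda>(x, u). f n x u) \<in> borel_measurable (restrict_space borel D \<Otimes>\<^sub>M restrict_space borel U)"
    and f_bounded: "\<exists>B. \<forall>n<N. \<forall>x\<in>D. \<forall>u\<in>U. \<bar>f n x u\<bar> \<le> B"
    and g_meas: "g \<in> borel_measurable (restrict_space borel D)"
    and g_bounded: "\<exists>B. \<forall>x\<in>D. \<bar>g x\<bar> \<le> B"
    and V_meas: "\<And>n. n \<le> N \<Longrightarrow> V n \<in> borel_measurable (restrict_space borel D)"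
    and V_dynamic_programming: "\<And>n x. n < N \<Longrightarrow> x \<in> D \<Longrightarrow>
           V n x = (SUP u\<in>U. f n x u + (\<integral>e. V (n + 1) (dyn n x e u) \<partial>unif01))"
    and V_bound: "\<And>n x. n \<le> N \<Longrightarrow> x \<in> D \<Longrightarrow> \<bar>V n x\<bar> \<le> \<Gamma>"
    and \<phi>: "\<And>k. \<phi> k \<in> l2_space \<mu>" "l2_independent \<mu> \<phi>"
    and f_usc: "\<And>n x. n < N \<Longrightarrow> x \<in> D \<Longrightarrow> upper_semicontinuous_on U (f n x)"
    and basis_hat_usc: "\<And>n k x. n < N \<Longrightarrow> x \<in> D \<Longrightarrow>
           upper_semicontinuous_on U (basis_hat \<mu> r \<phi> n k x)"
    and u_hat_meas: "\<And>n. n < N \<Longrightarrow> (\<lambda>(\<omega>, x). u_hat n (\<alpha> \<omega> (n + 1)) x) \<in> measurable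
           (train_measure \<mu> N M (N - n)) (restrict_space borel U)"
    and u_hat_argmax: "\<And>n \<omega> x u. n < N \<Longrightarrow> (\<omega>, x) \<in> space (train_measure \<mu> N M (N - n)) \<Longrightarrow>
           u \<in> U \<Longrightarrow>
           approx_Q \<mu> r f \<phi> n (\<alpha> \<omega> (n + 1)) x u
             \<le> approx_Q \<mu> r f \<phi> n (\<alpha> \<omega> (n + 1)) x (u_hat n (\<alpha> \<omega> (n + 1)) x)"
    and n: "n \<le> N"
  shows "(\<lambda>(\<omega>, x). Vt \<omega> n x - V n x) \<in> l2_space (train_measure \<mu> N M (N - n)) \<and>
         l2_norm (train_measure \<mu> N M (N - n)) (\<lambda>(\<omega>, x). Vt \<omega> n x - V n x)
           \<le> 2 * R * growth_factor R (N - n) *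
             (Max ((\<lambda>s. l2_norm \<mu> (\<lambda>x. l2_proj \<mu> \<phi> (V s) x - V s x)) ` {1..N})
              + sqrt (real CARD('k)) / sqrt (real M) * \<Gamma>
                * onorm ((*v) (psd_sqrt (matrix_inv (gram \<mu> \<phi>))))
                * Max (range (\<lambda>k. l2_norm \<mu> (\<phi> k))))"
proof -
  interpret \<mu>: prob_space \<mu> by (rule \<mu>(1))
  let ?C = "restrict_space borel U"
  have space_\<mu>: "space \<mu> = D"
    using sets_eq_imp_space_eq[OF \<mu>(2)] by (simp add: space_restrict_space)
  have space_C: "space ?C = U" by (simp add: space_restrict_space)
  obtain x\<^sub>0 where x0: "x\<^sub>0 \<in> D" using \<mu>.not_empty space_\<mu> by blast
  \<comment> \<open>A point of this space is needed to evaluate the policy at time 0. The resulting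
    value shows that \<open>U\<close> is nonempty, so that constant controls are admissible.\<close>
  have "space (train_measure \<mu> N M N) \<noteq> {}"
  proof -
    have "(\<lambda>i\<in>{1..M} \<times> {N - N + 1..N}. x\<^sub>0, x\<^sub>0) \<in> space (train_measure \<mu> N M N)"
      using x0 by (auto simp: train_measure_def space_pair_measure space_PiM space_\<mu>)
    then show ?thesis by blast
  qed
  then obtain u\<^sub>0 where u0: "u\<^sub>0 \<in> U"
    using measurable_space[OF u_hat_meas[of 0]] \<open>N \<ge> 1\<close> space_C by fastforce
  then have "(\<lambda>_ _. u\<^sub>0) \<in> feedback_controls N D U"
    by (simp add: feedback_controls_def space_C)
  then have V_N: "V N x = g x" for x
    unfolding V_def by (intro value_fn_terminal) blast
  have r_section: "r n x u \<in> borel_measurable \<mu>" if "n < N" "x \<in> D" "u \<in> U" for n x u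
  proof -
    have "(\<lambda>y. (x, u, y)) \<in> measurable \<mu> (restrict_space borel D \<Otimes>\<^sub>M ?C \<Otimes>\<^sub>M restrict_space borel D)"
      using that
      by (intro measurable_Pair measurable_const measurable_ident_sets[OF \<mu>(2)])
        (simp_all add: space_restrict_space)
    from measurable_compose[OF this r_meas[OF that(1)]] show ?thesis by simp
  qed
  have r_int: "integrable \<mu> (r n x u)" if "n < N" "x \<in> D" "u \<in> U" for n x u
    using r_bound[OF that] space_\<mu>
    by (intro \<mu>.integrable_const_bound[where B = "R\<^sup>2"] r_section that AE_I2) auto
  have dyn_section: "(\<lambda>e. dyn n x e u) \<in> measurable unif01 \<mu>" if "n < N" "x \<in> D" "u \<in> U" for n x u
  proof -
    have "(\<lambda>e. (x, e, u)) \<in> measurable unif01 (restrict_space borel D \<Otimes>\<^sub>M restrict_space borel {0..1} \<Otimes>\<^sub>M ?C)"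
      using that
      by (intro measurable_Pair measurable_const measurable_ident_sets[OF sets_unif01])
        (simp_all add: space_restrict_space)
    from measurable_compose[OF this dyn[OF that(1)]] show ?thesis
      by (simp add: measurable_cong_sets[OF refl \<mu>(2)])
  qed
  \<comment> \<open>The next state always lies in \<open>space \<mu>\<close>, so the density formula
    for this certain event gives total mass one.\<close>
  have r_total: "(\<integral>y. r n x u y \<partial>\<mu>) = 1" if "n < N" "x \<in> D" "u \<in> U" for n x u
  proof -
    have "{e \<in> space unif01. dyn n x e u \<in> space \<mu>} = space unif01"
      using measurable_space[OF dyn_section[OF that]] by blast
    then have "(LINT y:space \<mu>|\<mu>. r n x u y) = 1"
      using r_density[OF that sets.top] prob_space.prob_space[OF prob_space_unif01] by simp
    then show ?thesis
      by (simp only: set_integral_space[OF r_int[OF that]])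
  qed
  \<comment> \<open>The expectation over the noise in the dynamic programming equation becomes an
    integral against the transition density, the form required by the abstract setting.\<close>
  have DP: "V n x = (SUP u\<in>U. f n x u + (\<integral>y. V (Suc n) y * r n x u y \<partial>\<mu>))"
    if "n < N" "x \<in> D" for n x
  proof -
    have "(\<integral>e. V (n + 1) (dyn n x e u) \<partial>unif01) = (\<integral>y. V (Suc n) y * r n x u y \<partial>\<mu>)" if u: "u \<in> U" for u
      unfolding Suc_eq_plus1
    proof (rule integral_transition_density)
      show "V (n + 1) \<in> borel_measurable \<mu>"
        using V_meas[of "n + 1"] \<open>n < N\<close> measurable_cong_sets[OF \<mu>(2) refl] by auto
      show "0 \<le> r n x u y" if "y \<in> space \<mu>" for y
        using r_bound[OF \<open>n < N\<close> \<open>x \<in> D\<close> u] that space_\<mu> by blast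
      show "(\<lambda>e. dyn n x e u) \<in> measurable unif01 \<mu>"
        by (rule dyn_section[OF \<open>n < N\<close> \<open>x \<in> D\<close> u])
      show "integrable \<mu> (r n x u)"
        by (rule r_int[OF \<open>n < N\<close> \<open>x \<in> D\<close> u])
      show "measure unif01 {e \<in> space unif01. dyn n x e u \<in> A} = (LINT y:A|\<mu>. r n x u y)"
        if "A \<in> sets \<mu>" for A
        by (rule r_density[OF \<open>n < N\<close> \<open>x \<in> D\<close> u that])
    qed (fact prob_space_unif01 \<mu>.finite_measure_axioms)+
    then show ?thesis
      unfolding V_dynamic_programming[OF that] by (intro SUP_cong refl) simp
  qed
  interpret regress_later_policy \<mu> \<phi> ?C N M r R \<Gamma> f g V u_hat
  proof (unfold_locales; (unfold space_C space_\<mu>)?)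
    show "l2_independent \<mu> \<phi>" by (rule \<phi>(2))
    show "\<phi> k \<in> l2_space \<mu>" for k by (rule \<phi>(1))
    show "M \<ge> 1" by fact
    show "(\<lambda>(x, u, y). r n x u y) \<in> borel_measurable (\<mu> \<Otimes>\<^sub>M ?C \<Otimes>\<^sub>M \<mu>)" if "n < N" for n
      using r_meas[OF that]
        measurable_cong_sets[OF sets_pair_measure_cong[OF \<mu>(2) sets_pair_measure_cong[OF refl \<mu>(2)]] refl]
      by blast
    show "(\<integral>y. r n x u y \<partial>\<mu>) = 1" if "n < N" "x \<in> D" "u \<in> U" for n x u
      by (rule r_total[OF that])
    show "0 \<le> r n x u y \<and> r n x u y \<le> R\<^sup>2" if "n < N" "x \<in> D" "u \<in> U" "y \<in> D" for n x u y
      by (rule r_bound[OF that])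
    show "R > 0" by (rule R)
    show "(\<lambda>(x, u). f n x u) \<in> borel_measurable (\<mu> \<Otimes>\<^sub>M ?C)" if "n < N" for n
      using f_meas[OF that] measurable_cong_sets[OF sets_pair_measure_cong[OF \<mu>(2) refl] refl] by blast
    show "\<exists>B. \<forall>n<N. \<forall>x\<in>D. \<forall>u\<in>U. \<bar>f n x u\<bar> \<le> B" by (rule f_bounded)
    show "V n \<in> borel_measurable \<mu>" if "n \<le> N" for n
      using V_meas[OF that] measurable_cong_sets[OF \<mu>(2) refl] by blast
    show "\<bar>V n x\<bar> \<le> \<Gamma>" if "n \<le> N" "x \<in> D" for n x
      by (rule V_bound[OF that])
    show "V N x = g x" for x by (rule V_N)
    show "V n x = (SUP u\<in>U. f n x u + (\<integral>y. V (Suc n) y * r n x u y \<partial>\<mu>))" if "n < N" "x \<in> D" for n x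
      by (rule DP[OF that])
    show "(\<lambda>(\<omega>, x). u_hat n (alpha_hat N M U \<mu> r f g \<Gamma> \<phi> \<omega> (Suc n)) x)
        \<in> measurable (train_measure \<mu> N M (N - n)) ?C" if "n < N" for n
      using u_hat_meas[OF that] by (simp add: \<alpha>_def)
    show "approx_Q \<mu> r f \<phi> n (alpha_hat N M U \<mu> r f g \<Gamma> \<phi> \<omega> (Suc n)) x u
        \<le> approx_Q \<mu> r f \<phi> n (alpha_hat N M U \<mu> r f g \<Gamma> \<phi> \<omega> (Suc n)) x
             (u_hat n (alpha_hat N M U \<mu> r f g \<Gamma> \<phi> \<omega> (Suc n)) x)"
      if "n < N" "(\<omega>, x) \<in> space (train_measure \<mu> N M (N - n))" "u \<in> U" for n \<omega> x u
      using u_hat_argmax[OF that] by (simp add: \<alpha>_def)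
  qed
  show ?thesis
    using performance_bound[OF n]
    unfolding Vt_def space_C approximation_error_def statistical_error_def .
qed

end
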